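(* Let $L/K$ be a finite field extension and $G=G(L/K)$ the group of $K$-algebra automorphisms of $L$. The following are equivalent: (a) $L/K$ is a Galois field extension; (b) $|G|=[L:K]$; (c) $L/K$ is a G-extension.
   Context: For a finite field extension $L/K$, let $E=\mathrm{End}_K(L)$ be the algebra of $K$-linear endomorphisms of $L$. The group $G=G(L/K)$ of $K$-algebra automorphisms of $L$ is a subset of $E$, and $L$ is regarded as a $K$-subalgebra of $E$ via multiplication. $L\rtimes G$ denotes the $K$-subalgebra of $E$ generated by $L$ and $G$, i.e. $L\rtimes G=\sum_{g\in G}Lg$ (this sum is direct, with multiplication $\lambda g\cdot\mu h=\lambda g(\mu)gh$ for $\lambda,\mu\in L$, $g,h\in G$). A finite field extension $L/K$ is called a G-extension if $E=L\rtimes G$. *)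

theory Defs
  imports "HOL-Algebra.Algebra"
begin

text \<open>
  A field extension \<open>L/K\<close> is given by a field \<^term>\<open>L\<close> (a ring record) and a subset \<^term>\<open>K\<close> of
  its carrier with \<^prop>\<open>subfield K L\<close>. Maps \<open>L \<Rightarrow> L\<close> are taken to be extensional outside
  \<^term>\<open>carrier L\<close>, so that equality of maps is equality on \<open>L\<close>.
\<close>

section \<open>Galois extensions\<close>

text \<open>
  A polynomial over \<open>L\<close> is separable if it has no multiple root in an algebraic closure.
  If \<open>L/K\<close> is algebraic, the algebraic closure of \<open>L\<close> is also one of \<open>K\<close>, so this is
  the usual notion for polynomials with coefficients in \<open>K\<close>. The map \<open>\<sigma>\<close> is the library's
  coefficientwise embedding of \<open>L[X]\<close> into \<open>\<Omega>[X]\<close>, where \<open>\<Omega>\<close> is the algebraic closure of \<open>L\<close>.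
\<close>

definition separable_poly :: "('a, 'b) ring_scheme \<Rightarrow> 'a list \<Rightarrow> bool" where
  "separable_poly L p \<longleftrightarrow>
     p \<noteq> [] \<and>
     (\<forall>a \<in> carrier (field.alg_closure L).
        ring.alg_mult (field.alg_closure L) (ring.\<sigma> L p) a \<le> 1)"

definition algebraic_extension :: "'a set \<Rightarrow> ('a, 'b) ring_scheme \<Rightarrow> bool" where
  "algebraic_extension K L \<longleftrightarrow> (\<forall>x \<in> carrier L. \<not> ring.transcendental L K x)"

definition separable_extension :: "'a set \<Rightarrow> ('a, 'b) ring_scheme \<Rightarrow> bool" where
  "separable_extension K L \<longleftrightarrow>
     algebraic_extension K L \<and> (\<forall>x \<in> carrier L. separable_poly L (ring.Irr L K x))"

definition normal_extension :: "'a set \<Rightarrow> ('a, 'b) ring_scheme \<Rightarrow> bool" where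
  "normal_extension K L \<longleftrightarrow>
     algebraic_extension K L \<and>
     (\<forall>p \<in> carrier (K[X]\<^bsub>L\<^esub>). pirreducible\<^bsub>L\<^esub> K p \<longrightarrow> (\<exists>x. ring.is_root L p x) \<longrightarrow> ring.splitted L p)"

definition galois_extension :: "'a set \<Rightarrow> ('a, 'b) ring_scheme \<Rightarrow> bool" where
  "galois_extension K L \<longleftrightarrow> normal_extension K L \<and> separable_extension K L"


section \<open>The automorphism group and the endomorphism algebra\<close>

definition aut_group :: "'a set \<Rightarrow> ('a, 'b) ring_scheme \<Rightarrow> ('a \<Rightarrow> 'a) monoid" where
  "aut_group K L = BijGroup (carrier L)
     \<lparr>carrier := {g \<in> ring_iso L L \<inter> extensional (carrier L). \<forall>k \<in> K. g k = k}\<rparr>"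

definition linear_endos :: "'a set \<Rightarrow> ('a, 'b) ring_scheme \<Rightarrow> ('a \<Rightarrow> 'a) set" where
  "linear_endos K L =
     {f \<in> hom (add_monoid L) (add_monoid L) \<inter> extensional (carrier L).
        \<forall>k \<in> K. \<forall>x \<in> carrier L. f (k \<otimes>\<^bsub>L\<^esub> x) = k \<otimes>\<^bsub>L\<^esub> f x}"

definition End_alg :: "'a set \<Rightarrow> ('a, 'b) ring_scheme \<Rightarrow> ('a, 'a \<Rightarrow> 'a) module" where
  "End_alg K L =
     \<lparr>partial_object.carrier = linear_endos K L,
      monoid.mult = (\<lambda>f g. compose (carrier L) f g),
      monoid.one = (\<lambda>x \<in> carrier L. x),
      ring.zero = (\<lambda>x \<in> carrier L. \<zero>\<^bsub>L\<^esub>),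
      ring.add = (\<lambda>f g. \<lambda>x \<in> carrier L. f x \<oplus>\<^bsub>L\<^esub> g x),
      module.smult = (\<lambda>k f. \<lambda>x \<in> carrier L. k \<otimes>\<^bsub>L\<^esub> f x)\<rparr>"

definition mult_map :: "('a, 'b) ring_scheme \<Rightarrow> 'a \<Rightarrow> 'a \<Rightarrow> 'a" where
  "mult_map L a = (\<lambda>x \<in> carrier L. a \<otimes>\<^bsub>L\<^esub> x)"


lemma linear_endosD:
  assumes "f \<in> linear_endos K L"
  shows "\<And>x. x \<in> carrier L \<Longrightarrow> f x \<in> carrier L"
    and "\<And>x y. x \<in> carrier L \<Longrightarrow> y \<in> carrier L \<Longrightarrow> f (x \<oplus>\<^bsub>L\<^esub> y) = f x \<oplus>\<^bsub>L\<^esub> f y"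
    and "\<And>k x. k \<in> K \<Longrightarrow> x \<in> carrier L \<Longrightarrow> f (k \<otimes>\<^bsub>L\<^esub> x) = k \<otimes>\<^bsub>L\<^esub> f x"
    and "f \<in> extensional (carrier L)"
  using assms by (auto simp: linear_endos_def hom_def Pi_def)

lemma linear_endosI:
  assumes "\<And>x. x \<in> carrier L \<Longrightarrow> f x \<in> carrier L"
    and "\<And>x y. x \<in> carrier L \<Longrightarrow> y \<in> carrier L \<Longrightarrow> f (x \<oplus>\<^bsub>L\<^esub> y) = f x \<oplus>\<^bsub>L\<^esub> f y"
    and "\<And>k x. k \<in> K \<Longrightarrow> x \<in> carrier L \<Longrightarrow> f (k \<otimes>\<^bsub>L\<^esub> x) = k \<otimes>\<^bsub>L\<^esub> f x"
    and "f \<in> extensional (carrier L)"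
  shows "f \<in> linear_endos K L"
  using assms by (auto simp: linear_endos_def hom_def Pi_def)

context
  fixes L :: "('a, 'b) ring_scheme" and K :: "'a set"
  assumes L: "field L" and K: "subfield K L"
begin

interpretation field L by (rule L)

lemma K_sub: "k \<in> K \<Longrightarrow> k \<in> carrier L"
  using subfieldE(3)[OF K] by auto

lemma ring_End_alg: "ring (End_alg K L)"
proof (intro ringI abelian_groupI monoidI)
  fix f assume f: "f \<in> carrier (End_alg K L)"
  note d = linear_endosD[OF f[unfolded End_alg_def, simplified]]
  let ?g = "\<lambda>x \<in> carrier L. \<ominus>\<^bsub>L\<^esub> f x"
  have "?g \<in> linear_endos K L"
    by (rule linear_endosI) (auto simp: d minus_add K_sub r_minus)
  moreover have "?g \<oplus>\<^bsub>End_alg K L\<^esub> f = \<zero>\<^bsub>End_alg K L\<^esub>"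
    by (auto simp: End_alg_def d l_neg intro!: restrict_ext)
  ultimately show "\<exists>g\<in>carrier (End_alg K L). g \<oplus>\<^bsub>End_alg K L\<^esub> f = \<zero>\<^bsub>End_alg K L\<^esub>"
    by (intro bexI[of _ ?g]) (simp_all add: End_alg_def)
qed (auto simp: End_alg_def compose_def K_sub linear_endosD a_assoc a_comm a_lcomm r_distr l_distr
       m_closed intro!: linear_endosI extensionalityI[of _ "carrier L"] intro: linear_endosD restrict_ext
       dest: linear_endosD(4))

lemma module_End_alg: "module (L\<lparr>carrier := K\<rparr>) (End_alg K L)"
proof (rule module.intro)
  show "cring (L\<lparr>carrier := K\<rparr>)" using subfield_iff(2)[OF K] field.axioms(1) domain.axioms(1) by blast
  show "abelian_group (End_alg K L)" using ring_End_alg ring.is_abelian_group by blast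
  show "module_axioms (L\<lparr>carrier := K\<rparr>) (End_alg K L)"
    by standard (auto simp: End_alg_def K_sub linear_endosD l_distr r_distr m_assoc m_lcomm
      intro!: linear_endosI extensionalityI[of _ "carrier L"] intro: linear_endosD dest: linear_endosD(4))
qed

lemma subgroup_aut_group: "subgroup (carrier (aut_group K L)) (BijGroup (carrier L))"
proof (rule group.subgroupI[OF group_BijGroup])
  let ?A = "carrier (aut_group K L)"
  show A: "?A \<subseteq> carrier (BijGroup (carrier L))"
    by (auto simp: aut_group_def BijGroup_def Bij_def ring_iso_def)
  have "(\<lambda>x \<in> carrier L. x) \<in> ?A"
    by (auto simp: aut_group_def ring_iso_def ring_hom_def K_sub bij_betw_def inj_on_def)
  thus "?A \<noteq> {}" by auto
  fix g assume g: "g \<in> ?A"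
  hence gi: "g \<in> ring_iso L L" "\<And>k. k \<in> K \<Longrightarrow> g k = k" by (auto simp: aut_group_def)
  have inj: "inj_on g (carrier L)" using gi by (auto simp: ring_iso_def bij_betw_def)
  have gB: "g \<in> Bij (carrier L)" using g A by (auto simp: BijGroup_def)
  have "(\<lambda>x \<in> carrier L. inv_into (carrier L) g x) \<in> ring_iso L L"
    by (rule ring_iso_restrict[OF ring_iso_set_sym[OF ring_axioms gi(1)]]) simp
  thus "inv\<^bsub>BijGroup (carrier L)\<^esub> g \<in> ?A"
    using inj gi(2) K_sub by (auto simp: aut_group_def inv_BijGroup[OF gB] intro: inv_into_f_eq)
  fix h assume h: "h \<in> ?A"
  have "compose (carrier L) g h \<in> ring_iso L L"
    using ring_iso_restrict[OF ring_iso_set_trans[of h L L g L]] g h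
    by (auto simp: aut_group_def compose_def)
  thus "g \<otimes>\<^bsub>BijGroup (carrier L)\<^esub> h \<in> ?A"
    using g h A by (auto simp: aut_group_def BijGroup_def compose_eq K_sub)
qed

lemma generators: "mult_map L ` carrier L \<union> carrier (aut_group K L) \<subseteq> carrier (End_alg K L)"
  by (auto simp: mult_map_def aut_group_def End_alg_def K_sub r_distr m_assoc m_lcomm
     ring_iso_memE K_sub intro!: linear_endosI)
end


section \<open>G-extensions\<close>

text \<open>
  The library's locale \<open>algebra\<close> is for commutative algebras and its locale \<open>subalgebra\<close>
  describes linear subspaces only, whence the following definition of the (unital)
  \<open>R\<close>-subalgebras of a not necessarily commutative algebra.
\<close>

definition is_subalgebra ::
  "('a, 'c) ring_scheme \<Rightarrow> ('a, 'b, 'd) module_scheme \<Rightarrow> 'b set \<Rightarrow> bool" where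
  "is_subalgebra R A B \<longleftrightarrow> subring B A \<and> submodule B R A"

definition generated_subalgebra ::
  "('a, 'c) ring_scheme \<Rightarrow> ('a, 'b, 'd) module_scheme \<Rightarrow> 'b set \<Rightarrow> 'b set" where
  "generated_subalgebra R A S = \<Inter>{B. is_subalgebra R A B \<and> S \<subseteq> B}"

definition crossed_algebra :: "'a set \<Rightarrow> ('a, 'b) ring_scheme \<Rightarrow> ('a \<Rightarrow> 'a) set" where
  "crossed_algebra K L =
     generated_subalgebra (L\<lparr>carrier := K\<rparr>) (End_alg K L)
       (mult_map L ` carrier L \<union> carrier (aut_group K L))"

definition G_extension :: "'a set \<Rightarrow> ('a, 'b) ring_scheme \<Rightarrow> bool" where
  "G_extension K L \<longleftrightarrow> carrier (End_alg K L) = crossed_algebra K L"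

end

theory Submission
  imports Defs
begin

text \<open>
  Let \<open>n = [L:K]\<close>, \<open>E = End\<^sub>K(L)\<close> and \<open>G = G(L/K)\<close>. Regard \<open>E\<close> as a left vector space over \<open>L\<close>.

  A \<open>K\<close>-linear map \<open>L \<rightarrow> L\<close> is determined by its values on a \<open>K\<close>-basis of \<open>L\<close>, which are arbitrary; so \<open>E\<close> has
  dimension \<open>n\<close> over \<open>L\<close> (\<open>dimension_E\<close>). By Dedekind's lemma distinct automorphisms are linearly
  independent over \<open>L\<close> (\<open>automorphisms_independent\<close>), and their \<open>L\<close>-span is the algebra generated by \<open>L\<close> and \<open>G\<close>
  (\<open>crossed_algebra_eq_Span\<close>). Hence \<open>|G| \<le> n\<close>, and \<open>|G| = n\<close> holds exactly when this span is all of
  \<open>E\<close>, that is, when \<open>L/K\<close> is a G-extension.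

  If \<open>L/K\<close> is a G-extension, an element \<open>y\<close> fixed by \<open>G\<close> lies in \<open>K\<close>, because multiplication by \<open>y\<close>
  commutes with all of \<open>E\<close> (\<open>G_extension_fixed_in_K\<close>). The product of the \<open>X - z\<close> over the orbit of
  an element \<open>x\<close> then has coefficients in \<open>K\<close> and is divisible by the minimal polynomial of \<open>x\<close>. So
  that polynomial splits over \<open>L\<close> with simple roots, and \<open>L/K\<close> is normal and separable.

  If conversely \<open>L/K\<close> is Galois, adjoin a basis of \<open>L\<close> one element at a time. Minimal polynomials over
  each intermediate field \<open>F\<close>, transported along an embedding of \<open>F\<close> into \<open>L\<close>, split over \<open>L\<close> with
  simple roots, so there are as many extensions of the embedding to \<open>F(x)\<close> as the degree of \<open>F(x)/F\<close>
  (\<open>galois_embedding_count\<close>). At the top this gives \<open>n\<close> embeddings of \<open>L\<close> into itself, which are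
  automorphisms since \<open>L\<close> has finite dimension over \<open>K\<close>.
\<close>

section \<open>Coefficientwise images of polynomials\<close>

text \<open>
  Polynomials are lists with nonzero head, and a homomorphism of fields is injective; so applying
  it to all coefficients gives a polynomial again, without renormalising.
\<close>
lemma map_poly_ring_hom:
  assumes h: "h \<in> ring_hom R S" and R: "field R" and S: "field S"
  shows "map h \<in> ring_hom (poly_ring R) (poly_ring S)"
proof -
  interpret R: field R by (rule R)
  interpret S: field S by (rule S)
  interpret H: ring_hom_ring R S h
    using ring_hom_ringI2[OF R.ring_axioms S.ring_axioms h] .
  note closed = polynomial_hom[OF h R S]
  interpret UPR: ring "poly_ring R" using R.univ_poly_is_ring[OF R.carrier_is_subring] .
  have sub: "set p \<subseteq> carrier R" if "p \<in> carrier (poly_ring R)" for p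
    using that R.polynomial_incl unfolding univ_poly_carrier[symmetric] by blast
  have norm: "S.normalize (map h p) = map h p" if "p \<in> carrier (poly_ring R)" for p
    using closed[OF that] S.normalize_polynomial unfolding univ_poly_carrier[symmetric] by blast
  show ?thesis
  proof (rule ring_hom_memI)
    fix p q assume p: "p \<in> carrier (poly_ring R)" and q: "q \<in> carrier (poly_ring R)"
    show "map h (p \<otimes>\<^bsub>poly_ring R\<^esub> q) = map h p \<otimes>\<^bsub>poly_ring S\<^esub> map h q"
      using H.poly_mult_hom'[OF sub[OF p] sub[OF q]] norm[OF UPR.m_closed[OF p q]]
      unfolding univ_poly_mult by simp
    show "map h (p \<oplus>\<^bsub>poly_ring R\<^esub> q) = map h p \<oplus>\<^bsub>poly_ring S\<^esub> map h q"
      using H.poly_add_hom'[OF sub[OF p] sub[OF q]] norm[OF UPR.a_closed[OF p q]]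
      unfolding univ_poly_add by simp
  qed (use closed in \<open>auto simp: univ_poly_one\<close>)
qed

lemma map_poly_pdivides:
  assumes h: "h \<in> ring_hom R S" and R: "field R" and S: "field S"
    and p: "p \<in> carrier (poly_ring R)" and div: "p pdivides\<^bsub>R\<^esub> q"
  shows "map h p pdivides\<^bsub>S\<^esub> map h q"
  using div ring_hom_memE[OF map_poly_ring_hom[OF h R S]] p
  unfolding pdivides_def factor_def by auto

text \<open>
  A power of \<open>X - a\<close> dividing \<open>p\<close> is mapped to the same power of \<open>X - h a\<close>. This is how
  separability, which is a condition on roots in an algebraic closure, gives simple roots in \<open>L\<close>.
\<close>
lemma alg_mult_le_map_poly:
  assumes h: "h \<in> ring_hom R S" and R: "field R" and S: "field S"
    and p: "p \<in> carrier (poly_ring R)" "p \<noteq> []" and a: "a \<in> carrier R"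
  shows "ring.alg_mult R p a \<le> ring.alg_mult S (map h p) (h a)"
proof -
  interpret R: field R by (rule R)
  interpret S: field S by (rule S)
  interpret H: ring_hom_ring R S h
    using ring_hom_ringI2[OF R.ring_axioms S.ring_axioms h] .
  interpret UPR: domain "poly_ring R" using R.univ_poly_is_domain[OF R.carrier_is_subring] .
  interpret UPS: domain "poly_ring S" using S.univ_poly_is_domain[OF S.carrier_is_subring] .
  interpret M: ring_hom_ring "poly_ring R" "poly_ring S" "map h"
    using ring_hom_ringI2[OF UPR.ring_axioms UPS.ring_axioms map_poly_ring_hom[OF h R S]] .
  let ?f = "[\<one>\<^bsub>R\<^esub>, \<ominus>\<^bsub>R\<^esub> a]"
  have f: "?f \<in> carrier (poly_ring R)"
    using a unfolding univ_poly_carrier[symmetric] polynomial_def by simp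
  have "(?f [^]\<^bsub>poly_ring R\<^esub> R.alg_mult p a) pdivides\<^bsub>R\<^esub> p"
    using R.alg_multE(1)[OF a p] .
  from map_poly_pdivides[OF h R S _ this] f
  have "(map h ?f [^]\<^bsub>poly_ring S\<^esub> R.alg_mult p a) pdivides\<^bsub>S\<^esub> map h p"
    by (simp add: M.hom_nat_pow del: list.map)
  moreover have "map h ?f = [\<one>\<^bsub>S\<^esub>, \<ominus>\<^bsub>S\<^esub> h a]" using a by simp
  ultimately show ?thesis
    using S.alg_multE(2)[of "h a" "map h p"] polynomial_hom[OF h R S p(1)] p(2) a by simp
qed

definition linear_factor_prod :: "('a, 'b) ring_scheme \<Rightarrow> 'a set \<Rightarrow> 'a list" where
  "linear_factor_prod R A = (\<Otimes>\<^bsub>poly_ring R\<^esub> a \<in> A. [\<one>\<^bsub>R\<^esub>, \<ominus>\<^bsub>R\<^esub> a])"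

context field
begin

lemma linear_factor_closed: "a \<in> carrier R \<Longrightarrow> [\<one>, \<ominus> a] \<in> carrier (poly_ring R)"
  unfolding univ_poly_carrier[symmetric] polynomial_def by simp

lemma linear_factor_prod:
  assumes "finite A" "A \<subseteq> carrier R"
  shows "linear_factor_prod R A \<in> carrier (poly_ring R)" "linear_factor_prod R A \<noteq> []"
    and "roots (linear_factor_prod R A) = mset_set A" "splitted (linear_factor_prod R A)"
proof -
  interpret UP: domain "poly_ring R" using univ_poly_is_domain[OF carrier_is_subring] .
  let ?P = "linear_factor_prod R"
  have "?P A \<in> carrier (poly_ring R) \<and> ?P A \<noteq> [] \<and> roots (?P A) = mset_set A
         \<and> degree (?P A) = card A"
    using assms
  proof (induction rule: finite_induct)
    case empty
    have "[\<one>] \<in> carrier (poly_ring R)" using UP.one_closed by (simp add: univ_poly_one)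
    then show ?case
      by (simp add: linear_factor_prod_def univ_poly_one degree_zero_imp_empty_roots)
  next
    case (insert a A)
    let ?f = "[\<one>, \<ominus> a]"
    have a: "a \<in> carrier R" and fs: "(\<lambda>a. [\<one>, \<ominus> a]) \<in> A \<rightarrow> carrier (poly_ring R)"
      using insert.prems linear_factor_closed by auto
    have IH: "?P A \<in> carrier (poly_ring R)" "?P A \<noteq> []" "roots (?P A) = mset_set A"
        "degree (?P A) = card A" using insert by auto
    have eq: "?P (insert a A) = ?f \<otimes>\<^bsub>poly_ring R\<^esub> ?P A"
      unfolding linear_factor_prod_def
      using UP.finprod_insert[OF insert.hyps(1,2) fs linear_factor_closed[OF a]] .
    have "?P (insert a A) \<noteq> []"
      using UP.integral[of ?f "?P A"] IH(1,2) linear_factor_closed[OF a]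
      unfolding eq by (auto simp: univ_poly_zero)
    moreover have "degree (?P (insert a A)) = Suc (card A)"
      using poly_mult_degree_eq[OF carrier_is_subring, of ?f "?P A"] IH linear_factor_closed[OF a]
      unfolding eq univ_poly_mult univ_poly_carrier[symmetric]
      by (simp del: poly_mult.simps) (metis Suc_pred length_greater_0_conv)
    ultimately show ?case
      using poly_mult_degree_one_monic_imp_same_roots[OF a IH(1,2)] IH insert.hyps
        UP.m_closed[OF linear_factor_closed[OF a] IH(1)]
      unfolding eq[symmetric] by simp
  qed
  thus "?P A \<in> carrier (poly_ring R)" "?P A \<noteq> []" "roots (?P A) = mset_set A" "splitted (?P A)"
    unfolding splitted_def by auto
qed

end

text \<open>
  The coefficients of the product of the linear factors are symmetric in its roots. Hence an
  automorphism that permutes \<open>A\<close> fixes all of them.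
\<close>
lemma map_linear_factor_prod:
  assumes h: "h \<in> ring_hom R S" and R: "field R" and S: "field S"
    and A: "A \<subseteq> carrier R"
  shows "map h (linear_factor_prod R A) = linear_factor_prod S (h ` A)"
proof -
  interpret R: field R by (rule R)
  interpret S: field S by (rule S)
  interpret H: ring_hom_ring R S h
    using ring_hom_ringI2[OF R.ring_axioms S.ring_axioms h] .
  interpret UPR: domain "poly_ring R" using R.univ_poly_is_domain[OF R.carrier_is_subring] .
  interpret UPS: domain "poly_ring S" using S.univ_poly_is_domain[OF S.carrier_is_subring] .
  interpret M: ring_hom_cring "poly_ring R" "poly_ring S" "map h"
    by (intro ring_hom_cring.intro ring_hom_cring_axioms.intro UPR.is_cring UPS.is_cring
        map_poly_ring_hom[OF h R S])
  have inj: "inj_on h A"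
    using non_trivial_field_hom_is_inj[OF h R S] A by (meson inj_on_subset)
  have "map h (linear_factor_prod R A) = (\<Otimes>\<^bsub>poly_ring S\<^esub> a \<in> A. map h [\<one>\<^bsub>R\<^esub>, \<ominus>\<^bsub>R\<^esub> a])"
    unfolding linear_factor_prod_def
    using A R.linear_factor_closed by (subst M.hom_finprod) (auto simp: o_def)
  also have "\<dots> = (\<Otimes>\<^bsub>poly_ring S\<^esub> a \<in> A. [\<one>\<^bsub>S\<^esub>, \<ominus>\<^bsub>S\<^esub> h a])"
    using A S.linear_factor_closed by (intro UPS.finprod_cong') auto
  also have "\<dots> = linear_factor_prod S (h ` A)"
    unfolding linear_factor_prod_def
    using A S.linear_factor_closed by (subst UPS.finprod_reindex[OF _ inj]) auto
  finally show ?thesis .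
qed

section \<open>Linear combinations\<close>

lemma (in ring) combine_unit_vector:
  assumes "set Us \<subseteq> carrier R" "j < length Us"
  shows "combine (map (\<lambda>i. if i = j then \<one> else \<zero>) [0..<length Us]) Us = Us ! j"
  using assms
proof (induction Us arbitrary: j)
  case (Cons u Us)
  have eq: "map f [0..<length (u # Us)] = f 0 # map (\<lambda>i. f (Suc i)) [0..<length Us]"
    for f :: "nat \<Rightarrow> 'a"
    by (simp add: map_upt_Suc del: upt_Suc)
  show ?case
  proof (cases j)
    case 0
    have "map (\<lambda>i. if Suc i = j then \<one> else \<zero>) [0..<length Us] = replicate (length Us) \<zero>"
      using 0 by (simp add: map_replicate_trivial flip: map_replicate_const)
    then show ?thesis using Cons.prems 0 unfolding eq by (simp add: combine_replicate)
  next
    case (Suc k)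
    then show ?thesis using Cons.prems Cons.IH[of k] nth_mem[of k Us] unfolding eq
      by (auto simp: subset_iff)
  qed
qed simp

lemma (in cring) combine_commute:
  assumes "length Ks = length Us" "set Ks \<subseteq> carrier R" "set Us \<subseteq> carrier R"
  shows "combine Ks Us = combine Us Ks"
  using assms by (induction Ks Us rule: list_induct2) (auto simp: m_comm)

text \<open>The inductive step of the computation in Dedekind's independence lemma.\<close>
lemma (in cring) twist_step:
  assumes "a \<in> carrier R" "u \<in> carrier R" "v \<in> carrier R" "c \<in> carrier R"
    "p \<in> carrier R" "q \<in> carrier R"
  shows "a \<otimes> (u \<ominus> c) \<otimes> v \<oplus> (p \<ominus> c \<otimes> q) = (a \<otimes> (u \<otimes> v) \<oplus> p) \<ominus> c \<otimes> (a \<otimes> v \<oplus> q)"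
  using assms by algebra

section \<open>Endomorphisms as a vector space over the larger field\<close>

locale finite_field_extension = field L + subfield K L for K and L (structure) +
  assumes finite_dim: "finite_dimension K (carrier L)"

context finite_field_extension
begin

abbreviation "E \<equiv> End_alg K L"
abbreviation "G \<equiv> carrier (aut_group K L)"
abbreviation "n \<equiv> dim K (carrier L)"
abbreviation "scalars \<equiv> mult_map L ` carrier L"

lemma subfield_K: "subfield K L" by (rule subfield_axioms)

sublocale E: ring "End_alg K L"
  by (rule ring_End_alg[OF field_axioms subfield_K])

lemma dimension_n: "dimension n K (carrier L)"
  using finite_dimensionE[OF subfield_K finite_dim] by (simp add: over_def)

lemma algebraic: "x \<in> carrier L \<Longrightarrow> (algebraic over K) x"
  using finite_dimension_imp_algebraic[OF subfield_K carrier_is_subring finite_dim] .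

lemma algebraic_ext: "algebraic_extension K L"
  using algebraic unfolding algebraic_extension_def over_def by blast

lemma Irr_props:
  assumes "x \<in> carrier L"
  shows "Irr K x \<in> carrier (K[X])" "pirreducible K (Irr K x)" "eval (Irr K x) x = \<zero>"
  using IrrE[OF subfield_K assms algebraic[OF assms]] by auto

lemma Irr_carrier: "x \<in> carrier L \<Longrightarrow> Irr K x \<in> carrier (poly_ring L)"
  using carrier_polynomial_shell[OF subfieldE(1)[OF subfield_K] Irr_props(1)] .

lemma Irr_not_Nil: "x \<in> carrier L \<Longrightarrow> Irr K x \<noteq> []"
  using pirreducibleE(1)[OF subfieldE(1)[OF subfield_K] Irr_props(1,2)] .

lemma carrier_E: "carrier E = linear_endos K L"
  by (simp add: End_alg_def)

lemma E_simps:
  "\<zero>\<^bsub>E\<^esub> = (\<lambda>x \<in> carrier L. \<zero>)" "\<one>\<^bsub>E\<^esub> = (\<lambda>x \<in> carrier L. x)"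
  "x \<in> carrier L \<Longrightarrow> (f \<oplus>\<^bsub>E\<^esub> g) x = f x \<oplus> g x"
  "x \<in> carrier L \<Longrightarrow> (f \<otimes>\<^bsub>E\<^esub> g) x = f (g x)"
  by (auto simp: End_alg_def compose_def)

lemma mult_map_apply: "x \<in> carrier L \<Longrightarrow> mult_map L a x = a \<otimes> x"
  by (simp add: mult_map_def)

lemma mult_map_closed: "a \<in> carrier L \<Longrightarrow> mult_map L a \<in> carrier E"
  using generators[OF field_axioms subfield_K] by blast

lemma G_subset: "G \<subseteq> carrier E"
  using generators[OF field_axioms subfield_K] by blast

lemma G_iff: "g \<in> G \<longleftrightarrow> g \<in> ring_iso L L \<and> g \<in> extensional (carrier L) \<and> (\<forall>k \<in> K. g k = k)"
  by (auto simp: aut_group_def)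

lemma G_simps:
  assumes "g \<in> G"
  shows "x \<in> carrier L \<Longrightarrow> g x \<in> carrier L" "g \<one> = \<one>"
    "x \<in> carrier L \<Longrightarrow> y \<in> carrier L \<Longrightarrow> g (x \<otimes> y) = g x \<otimes> g y"
    "x \<in> carrier L \<Longrightarrow> y \<in> carrier L \<Longrightarrow> g (x \<oplus> y) = g x \<oplus> g y"
  using assms ring_iso_memE[of g L L] unfolding G_iff by auto

lemma E_eqI:
  assumes "f \<in> carrier E" "g \<in> carrier E" "\<And>x. x \<in> carrier L \<Longrightarrow> f x = g x"
  shows "f = g"
  using assms linear_endosD(4)[of _ K L] unfolding carrier_E by (meson extensionalityI)

lemma E_closed: "f \<in> carrier E \<Longrightarrow> x \<in> carrier L \<Longrightarrow> f x \<in> carrier L"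
  unfolding carrier_E by (rule linear_endosD(1))

lemma mult_map_hom: "mult_map L \<in> ring_hom L E"
proof (rule ring_hom_memI)
  fix x y assume x: "x \<in> carrier L" and y: "y \<in> carrier L"
  show "mult_map L (x \<otimes> y) = mult_map L x \<otimes>\<^bsub>E\<^esub> mult_map L y"
    using x y by (intro E_eqI E.m_closed mult_map_closed m_closed) (simp_all add: E_simps mult_map_apply m_assoc)
  show "mult_map L (x \<oplus> y) = mult_map L x \<oplus>\<^bsub>E\<^esub> mult_map L y"
    using x y by (intro E_eqI E.a_closed mult_map_closed a_closed) (simp_all add: E_simps mult_map_apply l_distr)
qed (auto simp: mult_map_closed, auto simp: E_simps mult_map_def)

sublocale mult_map: ring_hom_ring L E "mult_map L"
  by (rule ring_hom_ringI2[OF ring_axioms E.ring_axioms mult_map_hom])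

lemma one_not_zero_E: "\<one>\<^bsub>E\<^esub> \<noteq> \<zero>\<^bsub>E\<^esub>"
proof
  assume "\<one>\<^bsub>E\<^esub> = \<zero>\<^bsub>E\<^esub>"
  hence "\<one>\<^bsub>E\<^esub> \<one> = \<zero>\<^bsub>E\<^esub> \<one>" by simp
  thus False by (simp add: E_simps)
qed

text \<open>
  \<open>L\<close> acts on \<open>E\<close> from the left through its multiplication maps. As these form a subfield of the
  ring \<open>E\<close>, the theory of bases over a subfield of a noncommutative ring applies to \<open>E\<close>.
\<close>
lemma subfield_scalars: "subfield scalars E"
  using mult_map.img_is_subfield(2)[OF carrier_is_subfield one_not_zero_E] .

lemma mult_map_eq_zero_iff: "a \<in> carrier L \<Longrightarrow> mult_map L a = \<zero>\<^bsub>E\<^esub> \<longleftrightarrow> a = \<zero>"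
  using mult_map_apply[of \<one> a] mult_map.hom_zero E_simps(1) by force

text \<open>
  Evaluation at \<open>x\<close> turns a relation between endomorphisms into one between elements of \<open>L\<close>; the
  next lemmas restate spans and independence over the scalars in that form.
\<close>
lemma combine_apply:
  assumes "set as \<subseteq> carrier L" "set fs \<subseteq> carrier E" "x \<in> carrier L"
  shows "E.combine (map (mult_map L) as) fs x = combine as (map (\<lambda>f. f x) fs)"
  using assms
proof (induction fs arbitrary: as)
  case Nil
  then show ?case by (cases as) (simp_all add: E_simps)
next
  case (Cons f fs)
  then show ?case
    by (cases as) (simp_all add: E_simps mult_map_apply E_closed)
qed

lemma combine_scalars_closed:
  assumes "set as \<subseteq> carrier L" "set fs \<subseteq> carrier E"
  shows "E.combine (map (mult_map L) as) fs \<in> carrier E"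
  using assms mult_map_closed by (intro E.combine_in_carrier) auto

lemma scalars_listE:
  assumes "set As \<subseteq> scalars"
  obtains as where "set as \<subseteq> carrier L" "As = map (mult_map L) as"
proof -
  have "\<forall>A \<in> set As. \<exists>a. A = mult_map L a \<and> a \<in> carrier L" using assms by auto
  then obtain c where "\<forall>A \<in> set As. A = mult_map L (c A) \<and> c A \<in> carrier L" by metis
  hence "set (map c As) \<subseteq> carrier L" "As = map (mult_map L) (map c As)"
    by (auto simp: map_idI)
  thus thesis by (rule that)
qed

lemma Span_scalars_iff:
  assumes "set fs \<subseteq> carrier E"
  shows "f \<in> E.Span scalars fs \<longleftrightarrow>
    (\<exists>as. set as \<subseteq> carrier L \<and> length as = length fs \<and> f = E.combine (map (mult_map L) as) fs)"
proof -
  have "f \<in> E.Span scalars fs \<longleftrightarrow>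
      (\<exists>As. set As \<subseteq> scalars \<and> length As = length fs \<and> f = E.combine As fs)"
    by (rule E.Span_mem_iff_length_version[OF subfield_scalars assms])
  also have "\<dots> \<longleftrightarrow> (\<exists>as. set as \<subseteq> carrier L \<and> length as = length fs \<and> f = E.combine (map (mult_map L) as) fs)"
  proof
    assume "\<exists>As. set As \<subseteq> scalars \<and> length As = length fs \<and> f = E.combine As fs"
    then obtain As where As: "set As \<subseteq> scalars" "length As = length fs" "f = E.combine As fs" by blast
    obtain as where "set as \<subseteq> carrier L" "As = map (mult_map L) as" using scalars_listE[OF As(1)] .
    thus "\<exists>as. set as \<subseteq> carrier L \<and> length as = length fs \<and> f = E.combine (map (mult_map L) as) fs"
      using As by auto
  next
    assume "\<exists>as. set as \<subseteq> carrier L \<and> length as = length fs \<and> f = E.combine (map (mult_map L) as) fs"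
    then obtain as where as: "set as \<subseteq> carrier L" "length as = length fs"
        "f = E.combine (map (mult_map L) as) fs" by blast
    thus "\<exists>As. set As \<subseteq> scalars \<and> length As = length fs \<and> f = E.combine As fs"
      by (intro exI[of _ "map (mult_map L) as"]) auto
  qed
  finally show ?thesis .
qed

lemma independent_scalarsI:
  assumes "set fs \<subseteq> carrier E"
    and "\<And>as. set as \<subseteq> carrier L \<Longrightarrow> length as = length fs \<Longrightarrow>
      (\<And>x. x \<in> carrier L \<Longrightarrow> combine as (map (\<lambda>f. f x) fs) = \<zero>) \<Longrightarrow> set as \<subseteq> {\<zero>}"
  shows "E.independent scalars fs"
proof (rule ccontr)
  assume "\<not> E.independent scalars fs"
  then obtain As where As: "length As = length fs" "E.combine As fs = \<zero>\<^bsub>E\<^esub>"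
      "set As \<subseteq> scalars" "set As \<noteq> {\<zero>\<^bsub>E\<^esub>}"
    using E.dependent_imp_non_trivial_combine[OF subfield_scalars assms(1)] by blast
  obtain as where as: "set as \<subseteq> carrier L" "As = map (mult_map L) as"
    using scalars_listE[OF As(3)] .
  have "combine as (map (\<lambda>f. f x) fs) = \<zero>" if x: "x \<in> carrier L" for x
    using combine_apply[OF as(1) assms(1) x] As(2) x unfolding as(2) by (simp add: E_simps)
  hence "set as \<subseteq> {\<zero>}" using assms(2) as As(1) by simp
  hence "set As \<subseteq> {\<zero>\<^bsub>E\<^esub>}" unfolding as(2) by auto
  hence "set As = {}" using As(4) by (meson subset_singletonD)
  hence "fs = []" using As(1) by auto
  thus False using \<open>\<not> E.independent scalars fs\<close> by simp
qed

lemma independent_scalarsD: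
  assumes "E.independent scalars fs" "set as \<subseteq> carrier L" "length as = length fs"
    and zero: "\<And>x. x \<in> carrier L \<Longrightarrow> combine as (map (\<lambda>f. f x) fs) = \<zero>"
  shows "set as \<subseteq> {\<zero>}"
proof -
  have fs: "set fs \<subseteq> carrier E" using E.independent_in_carrier[OF assms(1)] .
  have "E.combine (map (mult_map L) as) fs = \<zero>\<^bsub>E\<^esub>"
    using combine_apply[OF assms(2) fs] zero
    by (intro E_eqI combine_scalars_closed[OF assms(2) fs] E.zero_closed) (simp add: E_simps)
  hence "set (take (length fs) (map (mult_map L) as)) \<subseteq> {\<zero>\<^bsub>E\<^esub>}"
    using assms(2) by (intro E.independent_imp_trivial_combine[OF subfield_scalars assms(1)]) auto
  thus ?thesis using assms(2,3) mult_map_eq_zero_iff by auto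
qed

lemma linear_combine:
  assumes "f \<in> carrier E" "set ks \<subseteq> K" "set Us \<subseteq> carrier L"
  shows "f (combine ks Us) = combine ks (map f Us)"
  using assms(2,3)
proof (induction ks Us rule: combine.induct)
  case (1 k Ks u Us)
  note f = linear_endosD[OF assms(1)[unfolded carrier_E]]
  have "k \<in> carrier L" "set Ks \<subseteq> carrier L" using 1 subfieldE(3)[OF subfield_K] by auto
  then show ?case using 1 by (simp add: f)
next
  case ("2_1" Us)
  have "f (\<zero> \<otimes> \<zero>) = \<zero> \<otimes> f \<zero>"
    using linear_endosD(3)[OF assms(1)[unfolded carrier_E]] subringE(2)[OF subfieldE(1)[OF subfield_K]] by blast
  then show ?case using E_closed[OF assms(1)] by simp
next
  case ("2_2" Ks)
  have "f (\<zero> \<otimes> \<zero>) = \<zero> \<otimes> f \<zero>"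
    using linear_endosD(3)[OF assms(1)[unfolded carrier_E]] subringE(2)[OF subfieldE(1)[OF subfield_K]] by blast
  then show ?case using E_closed[OF assms(1)] by simp
qed

text \<open>
  The coordinate functions, regarded as endomorphisms of \<open>L\<close> with values in \<open>K\<close>.
\<close>
lemma dual_basis:
  assumes Us: "independent K Us" "Span K Us = carrier L"
  obtains fs where "set fs \<subseteq> carrier E" "length fs = length Us"
    "\<And>x. x \<in> carrier L \<Longrightarrow> set (map (\<lambda>f. f x) fs) \<subseteq> K \<and> x = combine (map (\<lambda>f. f x) fs) Us"
    "\<And>j. j < length Us \<Longrightarrow>
       map (\<lambda>f. f (Us ! j)) fs = map (\<lambda>i. if i = j then \<one> else \<zero>) [0..<length Us]"
proof -
  have U: "set Us \<subseteq> carrier L" using independent_in_carrier[OF Us(1)] .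
  note KL = subfieldE(3)[OF subfield_K]
  note Kc = subringE[OF subfieldE(1)[OF subfield_K]]
  define P where "P = (\<lambda>x ks. set ks \<subseteq> K \<and> length ks = length Us \<and> x = combine ks Us)"
  define co where "co = (\<lambda>x. THE ks. P x ks)"
  have ex1: "\<exists>!ks. P x ks" if "x \<in> carrier L" for x
    using unique_decomposition[OF subfield_K Us(1)] that Us(2) unfolding P_def by blast
  have co: "P x (co x)" if "x \<in> carrier L" for x
    unfolding co_def by (rule theI'[OF ex1[OF that]])
  \<comment> \<open>Linearity of the coordinates follows from their uniqueness.\<close>
  have coI: "co x = ks" if "P x ks" for x ks
  proof -
    have "x \<in> carrier L" using that U KL unfolding P_def by auto
    thus ?thesis using ex1 co that by blast
  qed
  have co_add: "co (x \<oplus> y) = map2 (\<oplus>) (co x) (co y)" if "x \<in> carrier L" "y \<in> carrier L" for x y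
  proof (rule coI)
    note * = co[OF that(1), unfolded P_def] co[OF that(2), unfolded P_def]
    have "combine (co x) Us \<oplus> combine (co y) Us = combine (map2 (\<oplus>) (co x) (co y)) Us"
      using * KL U by (intro combine_add) auto
    hence "x \<oplus> y = combine (map2 (\<oplus>) (co x) (co y)) Us" using * by simp
    moreover have "set (map2 (\<oplus>) (co x) (co y)) \<subseteq> K"
    proof
      fix c assume "c \<in> set (map2 (\<oplus>) (co x) (co y))"
      then obtain a b where ab: "(a, b) \<in> set (zip (co x) (co y))" "c = a \<oplus> b" by auto
      have "a \<in> K" "b \<in> K" using set_zip_leftD[OF ab(1)] set_zip_rightD[OF ab(1)] * by auto
      thus "c \<in> K" using Kc(7) ab(2) by simp
    qed
    ultimately show "P (x \<oplus> y) (map2 (\<oplus>) (co x) (co y))" using * unfolding P_def by simp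
  qed
  have co_smult: "co (k \<otimes> x) = map ((\<otimes>) k) (co x)" if "k \<in> K" "x \<in> carrier L" for k x
  proof (rule coI)
    note * = co[OF that(2), unfolded P_def]
    have "k \<otimes> combine (co x) Us = combine (map ((\<otimes>) k) (co x)) Us"
      using * KL U that(1) by (intro combine_r_distr) auto
    thus "P (k \<otimes> x) (map ((\<otimes>) k) (co x))" using * Kc(6) that(1) unfolding P_def by auto
  qed
  have len: "length (co x) = length Us" if "x \<in> carrier L" for x using co[OF that] unfolding P_def by simp
  define fs where "fs = map (\<lambda>i. \<lambda>x \<in> carrier L. co x ! i) [0..<length Us]"
  have eval: "map (\<lambda>f. f x) fs = co x" if "x \<in> carrier L" for x
    using len[OF that] that unfolding fs_def by (intro nth_equalityI) auto
  show thesis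
  proof (rule that[of fs])
    show "set fs \<subseteq> carrier E"
    proof
      fix f assume "f \<in> set fs"
      then obtain i where i: "i < length Us" "f = (\<lambda>x \<in> carrier L. co x ! i)" unfolding fs_def by auto
      have inK: "co x ! i \<in> K" if "x \<in> carrier L" for x
        using co[OF that] i(1) nth_mem[of i "co x"] unfolding P_def by auto
      show "f \<in> carrier E" unfolding carrier_E i(2)
      proof (rule linear_endosI)
        fix k x assume kx: "k \<in> K" "x \<in> carrier L"
        hence "k \<otimes> x \<in> carrier L" using KL by auto
        thus "(\<lambda>x \<in> carrier L. co x ! i) (k \<otimes> x) = k \<otimes> (\<lambda>x \<in> carrier L. co x ! i) x"
          using kx len[OF kx(2)] i(1) by (simp add: co_smult)
      qed (use inK KL len i(1) in \<open>auto simp: co_add\<close>)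
    qed
    show "length fs = length Us" by (simp add: fs_def)
    show "set (map (\<lambda>f. f x) fs) \<subseteq> K \<and> x = combine (map (\<lambda>f. f x) fs) Us" if "x \<in> carrier L" for x
      using eval[OF that] co[OF that] unfolding P_def by simp
    fix j assume j: "j < length Us"
    have "Us ! j \<in> carrier L" using j U nth_mem by blast
    moreover have "co (Us ! j) = map (\<lambda>i. if i = j then \<one> else \<zero>) [0..<length Us]"
      using combine_unit_vector[OF U j] Kc(2,3) by (intro coI) (auto simp: P_def)
    ultimately show "map (\<lambda>f. f (Us ! j)) fs = map (\<lambda>i. if i = j then \<one> else \<zero>) [0..<length Us]"
      using eval by simp
  qed
qed

text \<open>
  The coordinate functions \<open>f\<^sub>i\<close> with respect to a \<open>K\<close>-basis \<open>u\<^sub>i\<close> of \<open>L\<close> form an \<open>L\<close>-basis of \<open>E\<close>: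
  every \<open>f\<close> is the sum of the \<open>f(u\<^sub>i) f\<^sub>i\<close>, and a relation between the \<open>f\<^sub>i\<close>, evaluated at \<open>u\<^sub>j\<close>,
  says that its \<open>j\<close>-th coefficient vanishes.
\<close>
lemma dimension_E: "E.dimension n scalars (carrier E)"
proof -
  obtain Us where Us: "set Us \<subseteq> carrier L" "independent K Us" "length Us = n" "Span K Us = carrier L"
    using exists_base[OF subfield_K dimension_n] by blast
  obtain fs where fs: "set fs \<subseteq> carrier E" "length fs = length Us"
    and coords: "\<And>x. x \<in> carrier L \<Longrightarrow> set (map (\<lambda>f. f x) fs) \<subseteq> K \<and> x = combine (map (\<lambda>f. f x) fs) Us"
    and unit: "\<And>j. j < length Us \<Longrightarrow>
       map (\<lambda>f. f (Us ! j)) fs = map (\<lambda>i. if i = j then \<one> else \<zero>) [0..<length Us]"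
    using dual_basis[OF Us(2,4)] by metis
  have "E.independent scalars fs"
  proof (rule independent_scalarsI[OF fs(1)])
    fix as assume as: "set as \<subseteq> carrier L" "length as = length fs"
      and zero: "\<And>x. x \<in> carrier L \<Longrightarrow> combine as (map (\<lambda>f. f x) fs) = \<zero>"
    have "as ! j = \<zero>" if j: "j < length as" for j
    proof -
      let ?u = "map (\<lambda>i. if i = j then \<one> else \<zero>) [0..<length as]"
      have "Us ! j \<in> carrier L" using j as fs Us(1) nth_mem[of j Us] by auto
      hence "\<zero> = combine as ?u" using zero[of "Us ! j"] unit[of j] j as(2) fs(2) by simp
      also have "\<dots> = combine ?u as" using as by (intro combine_commute) auto
      also have "\<dots> = as ! j" using combine_unit_vector[OF as(1) j] .
      finally show ?thesis by simp
    qed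
    thus "set as \<subseteq> {\<zero>}" by (auto simp: in_set_conv_nth)
  qed
  moreover have "E.Span scalars fs = carrier E"
  proof
    show "E.Span scalars fs \<subseteq> carrier E"
      using E.Span_in_carrier[OF subfieldE(3)[OF subfield_scalars] fs(1)] .
    show "carrier E \<subseteq> E.Span scalars fs"
    proof
      fix f assume f: "f \<in> carrier E"
      have fU: "set (map f Us) \<subseteq> carrier L" using E_closed[OF f] Us(1) by auto
      have "f = E.combine (map (mult_map L) (map f Us)) fs"
      proof (rule E_eqI[OF f combine_scalars_closed[OF fU fs(1)]])
        fix x assume x: "x \<in> carrier L"
        have c: "set (map (\<lambda>f. f x) fs) \<subseteq> K" using coords[OF x] by blast
        have "f x = f (combine (map (\<lambda>f. f x) fs) Us)" using coords[OF x] by simp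
        also have "\<dots> = combine (map (\<lambda>f. f x) fs) (map f Us)" by (rule linear_combine[OF f c Us(1)])
        also have "\<dots> = combine (map f Us) (map (\<lambda>f. f x) fs)"
          using c fU fs(2) subfieldE(3)[OF subfield_K] by (intro combine_commute) auto
        also have "\<dots> = E.combine (map (mult_map L) (map f Us)) fs x"
          using combine_apply[OF fU fs(1) x] by simp
        finally show "f x = E.combine (map (mult_map L) (map f Us)) fs x" .
      qed
      thus "f \<in> E.Span scalars fs"
        unfolding Span_scalars_iff[OF fs(1)] using fU fs(2) by (metis length_map)
    qed
  qed
  ultimately show ?thesis
    using E.dimensionI[OF subfield_scalars] fs(2) Us(3) by metis
qed

end

section \<open>Independence of automorphisms\<close>

context finite_field_extension
begin

text \<open>
  The value at \<open>y\<close> of the twisted relation with coefficients \<open>a\<^sub>i (g\<^sub>i(x) - c)\<close>. It is used with \<open>c = g(x)\<close>,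
  for which the right-hand side becomes \<open>g(x y) - g(x) g(y) = 0\<close>.
\<close>
lemma combine_twist:
  assumes "length as = length gs" "set as \<subseteq> carrier L" "set gs \<subseteq> G"
    and "c \<in> carrier L" "x \<in> carrier L" "y \<in> carrier L"
  shows "combine (map2 (\<lambda>a h. a \<otimes> (h x \<ominus> c)) as gs) (map (\<lambda>h. h y) gs) =
    combine as (map (\<lambda>h. h (x \<otimes> y)) gs) \<ominus> c \<otimes> combine as (map (\<lambda>h. h y) gs)"
  using assms(1-3)
proof (induction as gs rule: list_induct2)
  case Nil
  then show ?case using assms by (simp add: a_minus_def)
next
  case (Cons a as g gs)
  have g: "g x \<in> carrier L" "g y \<in> carrier L" "g (x \<otimes> y) = g x \<otimes> g y"
    using Cons.prems assms(5,6) G_simps[of g] by auto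
  have c1: "combine as (map (\<lambda>h. h (x \<otimes> y)) gs) \<in> carrier L"
    and c2: "combine as (map (\<lambda>h. h y) gs) \<in> carrier L"
    using Cons.prems assms(5,6) G_simps(1) by (intro combine_in_carrier; force)+
  show ?case using Cons twist_step[OF _ g(1,2) assms(4) c1 c2, of a] by (simp add: g(3))
qed

text \<open>
  Dedekind's lemma. If \<open>g\<close> is the sum of the \<open>a\<^sub>i g\<^sub>i\<close>, computing \<open>g(x y)\<close> in two ways shows that the sum of the
  \<open>a\<^sub>i (g\<^sub>i(x) - g(x)) g\<^sub>i\<close> is zero for every \<open>x\<close>. By induction all its coefficients vanish, and since
  \<open>g\<^sub>i \<noteq> g\<close> this forces \<open>a\<^sub>i = 0\<close>. Then \<open>g = 0\<close>, contradicting \<open>g(1) = 1\<close>.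
\<close>
lemma automorphisms_independent:
  assumes "distinct gs" "set gs \<subseteq> G"
  shows "E.independent scalars gs"
  using assms
proof (induction gs)
  case (Cons g gs)
  have gs: "set gs \<subseteq> carrier E" and g: "g \<in> G" and IH: "E.independent scalars gs"
    using Cons G_subset by auto
  have "g \<notin> E.Span scalars gs"
  proof
    assume "g \<in> E.Span scalars gs"
    then obtain as where as: "set as \<subseteq> carrier L" "length as = length gs"
      and geq: "g = E.combine (map (mult_map L) as) gs"
      unfolding Span_scalars_iff[OF gs] by blast
    have gx: "combine as (map (\<lambda>h. h x) gs) = g x" if "x \<in> carrier L" for x
      using combine_apply[OF as(1) gs that] geq by simp
    have "a = \<zero>" if a: "a \<in> set as" for a
    proof -
      obtain i where i: "i < length as" "a = as ! i" using a by (auto simp: in_set_conv_nth)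
      have h: "gs ! i \<in> set gs" using i as(2) by simp
      hence "gs ! i \<noteq> g" using Cons.prems by auto
      moreover have "gs ! i \<in> carrier E" "g \<in> carrier E" using h gs g G_subset by auto
      \<comment> \<open>The element \<open>x\<close> at which the relation is twisted must separate the two automorphisms.\<close>
      ultimately obtain x where x: "x \<in> carrier L" "(gs ! i) x \<noteq> g x" using E_eqI by blast
      let ?bs = "map2 (\<lambda>a h. a \<otimes> (h x \<ominus> g x)) as gs"
      have cl: "(gs ! i) x \<in> carrier L" "g x \<in> carrier L" "a \<in> carrier L"
        using x(1) h Cons.prems G_simps(1) a as(1) by auto
      have "set ?bs \<subseteq> {\<zero>}"
      proof (rule independent_scalarsD[OF IH])
        show "set ?bs \<subseteq> carrier L"
        proof
          fix c assume "c \<in> set ?bs"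
          then obtain b h where bh: "(b, h) \<in> set (zip as gs)" "c = b \<otimes> (h x \<ominus> g x)" by auto
          have "b \<in> carrier L" "h \<in> G"
            using set_zip_leftD[OF bh(1)] set_zip_rightD[OF bh(1)] as(1) Cons.prems by auto
          thus "c \<in> carrier L" using G_simps(1)[OF _ x(1)] cl(2) bh(2) by simp
        qed
        show "length ?bs = length gs" using as(2) by simp
        fix y assume y: "y \<in> carrier L"
        have "combine ?bs (map (\<lambda>h. h y) gs) = g (x \<otimes> y) \<ominus> g x \<otimes> g y"
          using combine_twist[OF as(2,1) _ cl(2) x(1) y] Cons.prems(2) gx x(1) y by simp
        also have "\<dots> = \<zero>" using G_simps(1,3)[OF g] x(1) y by (simp add: r_right_minus_eq)
        finally show "combine ?bs (map (\<lambda>h. h y) gs) = \<zero>" .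
      qed
      hence "?bs ! i = \<zero>" using i as(2) by (metis (no_types, lifting) in_mono length_map map_fst_zip nth_mem singletonD length_zip min.idem)
      hence "a \<otimes> ((gs ! i) x \<ominus> g x) = \<zero>" using i as(2) by simp
      thus "a = \<zero>" using x(2) cl integral r_right_minus_eq by blast
    qed
    hence "as = replicate (length gs) \<zero>" using as(2) by (simp add: replicate_eqI)
    hence "g \<one> = \<zero>"
    proof -
      have "set (map (\<lambda>h. h \<one>) gs) \<subseteq> carrier L" using gs E_closed by auto
      from combine_replicate[OF this] show ?thesis
        using gx[of \<one>] \<open>as = replicate (length gs) \<zero>\<close> by simp
    qed
    thus False using G_simps(2)[OF g] by simp
  qed
  thus ?case using IH g G_subset by (intro E.independent.li_Cons) auto
qed simp

lemma finite_G: "finite G" and card_G_le: "card G \<le> n"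
proof -
  have le: "card S \<le> n" if S: "finite S" "S \<subseteq> G" for S
  proof -
    obtain gs where gs: "set gs = S" "distinct gs" using finite_distinct_list[OF S(1)] by blast
    have "length gs \<le> n"
      using E.independent_length_le_dimension[OF subfield_scalars dimension_E automorphisms_independent] gs S G_subset
      by auto
    thus ?thesis using gs distinct_card[of gs] by simp
  qed
  show "finite G"
  proof (rule ccontr)
    assume "infinite G"
    then obtain S where S: "finite S" "card S = Suc n" "S \<subseteq> G"
      using infinite_arbitrarily_large by blast
    have "Suc n \<le> n" using le[OF S(1,3)] unfolding S(2) .
    thus False by (rule notE[OF Suc_n_not_le_n])
  qed
  thus "card G \<le> n" using le[OF _ subset_refl] by simp
qed

section \<open>The crossed algebra as a span\<close>

lemma one_in_G: "\<one>\<^bsub>E\<^esub> \<in> G"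
  using subgroup.one_closed[OF subgroup_aut_group[OF field_axioms subfield_K]]
  by (simp add: BijGroup_def E_simps)

lemma compose_G: "g \<in> G \<Longrightarrow> h \<in> G \<Longrightarrow> g \<otimes>\<^bsub>E\<^esub> h \<in> G"
  using subgroup.m_closed[OF subgroup_aut_group[OF field_axioms subfield_K], of g h]
    subgroup.subset[OF subgroup_aut_group[OF field_axioms subfield_K]]
  by (auto simp: BijGroup_def End_alg_def subset_iff)

lemma smult_E:
  assumes "k \<in> K" "f \<in> carrier E"
  shows "k \<odot>\<^bsub>E\<^esub> f = mult_map L k \<otimes>\<^bsub>E\<^esub> f"
  using assms E_closed[OF assms(2)] by (auto simp: End_alg_def mult_map_def compose_def)

lemma G_mult_map: "g \<in> G \<Longrightarrow> a \<in> carrier L \<Longrightarrow>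
    g \<otimes>\<^bsub>E\<^esub> mult_map L a = mult_map L (g a) \<otimes>\<^bsub>E\<^esub> g"
  using G_subset mult_map_closed G_simps
  by (intro E_eqI E.m_closed) (auto simp: E_simps mult_map_apply)

text \<open>
  By the commutation rule above, \<open>\<lambda>g \<cdot> \<mu>h = \<lambda>g(\<mu>) \<cdot> gh\<close>; so the \<open>L\<close>-span of the automorphisms is closed
  under composition and is the subalgebra generated by \<open>L\<close> and \<open>G\<close>.
\<close>
lemma crossed_algebra_eq_Span:
  assumes gs: "set gs = G"
  shows "crossed_algebra K L = E.Span scalars gs"
proof
  have gsE: "set gs \<subseteq> carrier E" using gs G_subset by simp
  let ?S = "E.Span scalars gs"
  note S = E.Span_subgroup_props[OF subfield_scalars gsE]
  note smult = E.Span_smult_closed[OF subfield_scalars gsE]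
  have GS: "G \<subseteq> ?S" using E.Span_base_incl[OF subfield_scalars gsE] gs by simp
  have scalS: "scalars \<subseteq> ?S"
  proof
    fix f assume f: "f \<in> scalars"
    hence "f \<otimes>\<^bsub>E\<^esub> \<one>\<^bsub>E\<^esub> \<in> ?S" using smult GS one_in_G by blast
    thus "f \<in> ?S" using f mult_map_closed by auto
  qed
  have Gmult: "g \<otimes>\<^bsub>E\<^esub> f \<in> ?S" if g: "g \<in> G" and f: "f \<in> ?S" for f g
  proof -
    have gE: "g \<in> carrier E" using g G_subset by blast
    obtain As where As: "set As \<subseteq> scalars" "f = E.combine As gs"
      using f E.Span_mem_iff_length_version[OF subfield_scalars gsE] by blast
    have "E.combine As hs \<in> carrier E \<and> g \<otimes>\<^bsub>E\<^esub> E.combine As hs \<in> ?S" if "set hs \<subseteq> G" for hs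
      using As(1) that
    proof (induction As hs rule: E.combine.induct)
      case (1 A As h hs)
      then obtain a where a: "a \<in> carrier L" "A = mult_map L a" by auto
      have h: "h \<in> G" "h \<in> carrier E" using 1 G_subset by auto
      have IH: "E.combine As hs \<in> carrier E" "g \<otimes>\<^bsub>E\<^esub> E.combine As hs \<in> ?S" using 1 by auto
      have AE: "A \<in> carrier E" using a mult_map_closed by simp
      have "g \<otimes>\<^bsub>E\<^esub> (A \<otimes>\<^bsub>E\<^esub> h) = mult_map L (g a) \<otimes>\<^bsub>E\<^esub> (g \<otimes>\<^bsub>E\<^esub> h)"
        using G_mult_map[OF g a(1)] a gE h(2) AE mult_map_closed[OF G_simps(1)[OF g a(1)]]
        by (metis E.m_assoc)
      also have "\<dots> \<in> ?S"
        using compose_G[OF g h(1)] GS G_simps(1)[OF g a(1)] smult by blast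
      finally show ?case using IH AE gE h S(3) by (simp add: E.r_distr del: E.Span.simps)
    qed (use gE S(2) in auto)
    thus ?thesis using gs As by blast
  qed
  have mult: "f \<otimes>\<^bsub>E\<^esub> f' \<in> ?S" if f: "f \<in> ?S" and f': "f' \<in> ?S" for f f'
  proof -
    obtain As where As: "set As \<subseteq> scalars" "f = E.combine As gs"
      using f E.Span_mem_iff_length_version[OF subfield_scalars gsE] by blast
    have f'E: "f' \<in> carrier E" using S(1) f' by blast
    have AsE: "set As \<subseteq> carrier E" using As(1) subfieldE(3)[OF subfield_scalars] by blast
    let ?hs = "map (\<lambda>g. g \<otimes>\<^bsub>E\<^esub> f') gs"
    have "f \<otimes>\<^bsub>E\<^esub> f' = E.combine As ?hs"
      unfolding As(2) by (rule E.combine_l_distr[OF AsE gsE f'E])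
    moreover have hs: "set ?hs \<subseteq> ?S" using Gmult[OF _ f'] gs by auto
    hence hsE: "set ?hs \<subseteq> carrier E" using S(1) by blast
    ultimately have "f \<otimes>\<^bsub>E\<^esub> f' \<in> E.Span scalars ?hs"
      using As(1) E.Span_eq_combine_set[OF subfield_scalars hsE] by blast
    thus ?thesis using E.mono_Span_subset[OF subfield_scalars hs gsE] by blast
  qed
  have "is_subalgebra (L\<lparr>carrier := K\<rparr>) E ?S"
    unfolding is_subalgebra_def
  proof
    show "subring ?S E"
      using S mult GS one_in_G by (intro E.subringI) auto
    interpret M: module "L\<lparr>carrier := K\<rparr>" E by (rule module_End_alg[OF field_axioms subfield_K])
    show "submodule ?S (L\<lparr>carrier := K\<rparr>) E"
    proof (rule M.submoduleI)
      fix k f assume "k \<in> carrier (L\<lparr>carrier := K\<rparr>)" and f: "f \<in> ?S"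
      hence k: "k \<in> K" by simp
      have "mult_map L k \<otimes>\<^bsub>E\<^esub> f \<in> ?S" using smult f k subfieldE(3)[OF subfield_K] by blast
      thus "k \<odot>\<^bsub>E\<^esub> f \<in> ?S" using smult_E[OF k] S(1) f by auto
    qed (use S in auto)
  qed
  thus "crossed_algebra K L \<subseteq> ?S"
    using GS scalS unfolding crossed_algebra_def generated_subalgebra_def by blast
  show "?S \<subseteq> crossed_algebra K L"
    unfolding crossed_algebra_def generated_subalgebra_def
  proof (intro Inter_greatest)
    fix B assume "B \<in> {B. is_subalgebra (L\<lparr>carrier := K\<rparr>) E B \<and> scalars \<union> G \<subseteq> B}"
    hence B: "subring B E" and incl: "scalars \<subseteq> B" "G \<subseteq> B" unfolding is_subalgebra_def by auto
    have "subalgebra scalars B E"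
      using subring.axioms(1)[OF B] subringE(6)[OF B] incl(1)
      by (intro subalgebra.intro subalgebra_axioms.intro) auto
    thus "?S \<subseteq> B" using E.subalgebra_Span_incl[OF subfield_scalars] incl(2) gs by blast
  qed
qed

text \<open>
  The independent family \<open>G\<close> spans the \<open>n\<close>-dimensional space \<open>E\<close> if and only if it has \<open>n\<close> members.
\<close>
lemma card_G_eq_iff_G_extension: "card G = n \<longleftrightarrow> G_extension K L"
proof -
  obtain gs where gs: "set gs = G" "distinct gs" using finite_distinct_list[OF finite_G] by blast
  have "length gs = n \<longleftrightarrow> E.Span scalars gs = carrier E"
    using E.independent_length_eq_dimension[OF subfield_scalars dimension_E automorphisms_independent] gs G_subset
    by auto
  thus ?thesis
    unfolding G_extension_def crossed_algebra_eq_Span[OF gs(1)] using gs distinct_card[of gs] by auto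
qed

section \<open>A G-extension is normal and separable\<close>

text \<open>
  Multiplication by a fixed element \<open>y\<close> commutes with \<open>L\<close> and with \<open>G\<close>, hence with all of \<open>E\<close> if \<open>L/K\<close>
  is a G-extension. So every \<open>K\<close>-linear endomorphism satisfies \<open>f(y) = f(1) y\<close>. If \<open>y\<close> were outside
  \<open>K\<close>, then \<open>y\<close> and \<open>1\<close> would be part of a basis, and the coordinate function of \<open>y\<close> violates this.
\<close>
lemma G_extension_fixed_in_K:
  assumes GE: "G_extension K L" and y: "y \<in> carrier L" and fixed: "\<And>g. g \<in> G \<Longrightarrow> g y = y"
  shows "y \<in> K"
proof (rule ccontr)
  assume yK: "y \<notin> K"
  obtain gs where gs: "set gs = G" using finite_list[OF finite_G] by blast
  have gsE: "set gs \<subseteq> carrier E" using gs G_subset by simp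
  have semi: "f y = f \<one> \<otimes> y" if f: "f \<in> carrier E" for f
  proof -
    have "f \<in> E.Span scalars gs"
      using f GE crossed_algebra_eq_Span[OF gs] unfolding G_extension_def by simp
    then obtain as where as: "set as \<subseteq> carrier L" "f = E.combine (map (mult_map L) as) gs"
      unfolding Span_scalars_iff[OF gsE] by blast
    have "f y = combine as (map (\<lambda>h. h y) gs)" using as combine_apply[OF as(1) gsE y] by simp
    also have "map (\<lambda>h. h y) gs = map (\<lambda>u. u \<otimes> y) (map (\<lambda>h. h \<one>) gs)"
    proof -
      have "h y = h \<one> \<otimes> y" if "h \<in> G" for h
        using fixed[OF that] G_simps(2)[OF that] y by simp
      thus ?thesis using gs by simp
    qed
    also have "combine as \<dots> = combine as (map (\<lambda>h. h \<one>) gs) \<otimes> y"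
      using as(1) gsE E_closed y by (intro combine_l_distr[symmetric]) auto
    also have "combine as (map (\<lambda>h. h \<one>) gs) = f \<one>" using as combine_apply[OF as(1) gsE] by simp
    finally show ?thesis .
  qed
  have Span1: "Span K [\<one>] = K"
  proof -
    have "k \<otimes> \<one> \<oplus> \<zero> = k" if "k \<in> K" for k using that subfieldE(3)[OF subfield_K] by auto
    thus ?thesis by (force simp: line_extension_mem_iff)
  qed
  have "\<one> \<notin> Span K []" by simp
  hence "independent K [\<one>]" by (intro independent.li_Cons) auto
  hence "independent K [y, \<one>]" using y yK Span1 by (intro independent.li_Cons[of y]) auto
  then obtain Vs where Vs: "independent K (Vs @ [y, \<one>])" "Span K (Vs @ [y, \<one>]) = carrier L"
    using complete_base[OF subfield_K dimension_n, of "[y, \<one>]"] y by auto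
  let ?Us = "Vs @ [y, \<one>]" and ?m = "length Vs"
  obtain fs where fs: "set fs \<subseteq> carrier E" "length fs = length ?Us"
    and unit: "\<And>j. j < length ?Us \<Longrightarrow>
       map (\<lambda>f. f (?Us ! j)) fs = map (\<lambda>i. if i = j then \<one> else \<zero>) [0..<length ?Us]"
    using dual_basis[OF Vs] by metis
  \<comment> \<open>In the extended basis \<open>y\<close> has index \<open>?m\<close> and \<open>1\<close> has index \<open>?m + 1\<close>.\<close>
  let ?f = "fs ! ?m"
  have f: "?f \<in> carrier E" using fs nth_mem[of ?m fs] by auto
  have val: "?f (?Us ! j) = (if ?m = j then \<one> else \<zero>)" if "j < length ?Us" for j
    using arg_cong[OF unit[OF that], of "\<lambda>l. l ! ?m"] fs(2) by (simp add: nth_append)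
  have "?f y = \<one>" using val[of ?m] by (simp add: nth_append)
  moreover have "?f \<one> = \<zero>" using val[of "Suc ?m"] by (simp add: nth_append)
  ultimately show False using semi[OF f] y by simp
qed

lemma G_hom: "g \<in> G \<Longrightarrow> g \<in> ring_hom L L"
  unfolding G_iff ring_iso_def by blast

text \<open>
  The polynomial with the simple roots \<open>g(x)\<close>, \<open>g \<in> G\<close>, is invariant under \<open>G\<close>, so its coefficients lie
  in the fixed field \<open>K\<close>. Since it vanishes at \<open>x\<close>, it is a multiple of the minimal polynomial of \<open>x\<close>,
  which therefore inherits its splitting and the simplicity of its roots.
\<close>
lemma G_extension_orbit_poly:
  assumes GE: "G_extension K L" and x: "x \<in> carrier L"
  shows "linear_factor_prod L ((\<lambda>g. g x) ` G) \<in> carrier (K[X])"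
    and "Irr K x pdivides linear_factor_prod L ((\<lambda>g. g x) ` G)"
proof -
  let ?O = "(\<lambda>g. g x) ` G"
  let ?P = "linear_factor_prod L ?O"
  have O: "finite ?O" "?O \<subseteq> carrier L" using finite_G G_simps(1) x by auto
  note P = linear_factor_prod[OF O]
  have "g c = c" if g: "g \<in> G" and c: "c \<in> set ?P" for g c
  proof -
    have "g ` ?O \<subseteq> ?O"
    proof
      fix z assume "z \<in> g ` ?O"
      then obtain h where h: "h \<in> G" "z = g (h x)" by auto
      hence "z = (g \<otimes>\<^bsub>E\<^esub> h) x" using x by (simp add: E_simps)
      thus "z \<in> ?O" using compose_G[OF g h(1)] by blast
    qed
    moreover have "inj_on g ?O"
      using non_trivial_field_hom_is_inj[OF G_hom[OF g] field_axioms field_axioms] O(2)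
      by (meson inj_on_subset)
    ultimately have "g ` ?O = ?O" using O(1) endo_inj_surj by blast
    hence "map g ?P = ?P"
      using map_linear_factor_prod[OF G_hom[OF g] field_axioms field_axioms O(2)] by simp
    hence "map g ?P = map (\<lambda>c. c) ?P" by simp
    thus "g c = c" using c by (simp only: map_eq_conv)
  qed
  moreover have "set ?P \<subseteq> carrier L"
    using P(1) polynomial_incl unfolding univ_poly_carrier[symmetric] by blast
  ultimately have "set ?P \<subseteq> K" using G_extension_fixed_in_K[OF GE] by blast
  thus PK: "?P \<in> carrier (K[X])"
    using P(1,2) unfolding univ_poly_carrier[symmetric] polynomial_def by simp
  have "x = \<one>\<^bsub>E\<^esub> x" using x by (simp add: E_simps)
  hence "x \<in> ?O" using one_in_G by blast
  hence "x \<in># roots ?P" unfolding P(3) using O(1) by simp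
  hence "eval ?P x = \<zero>" using roots_mem_iff_is_root[OF P(1)] unfolding is_root_def by simp
  thus "Irr K x pdivides ?P" using Irr_minimal[OF subfield_K x algebraic[OF x] PK] by simp
qed

lemma G_extension_imp_normal:
  assumes GE: "G_extension K L"
  shows "normal_extension K L"
  unfolding normal_extension_def
proof (intro conjI algebraic_ext ballI impI)
  fix p assume p: "p \<in> carrier (K[X])" "pirreducible K p" and "\<exists>x. is_root p x"
  then obtain x where x: "x \<in> carrier L" "eval p x = \<zero>" unfolding is_root_def by blast
  let ?O = "(\<lambda>g. g x) ` G"
  let ?P = "linear_factor_prod L ?O"
  have O: "finite ?O" "?O \<subseteq> carrier L" using finite_G G_simps(1) x(1) by auto
  note P = linear_factor_prod[OF O]
  note I = Irr_props[OF x(1)]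
  have "Irr K x divides\<^bsub>K[X]\<^esub> p"
    using Irr_minimal[OF subfield_K x(1) algebraic[OF x(1)] p(1) x(2)] pdivides_iff_shell[OF subfield_K I(1) p(1)] by simp
  hence "Irr K x \<sim>\<^bsub>K[X]\<^esub> p"
    using divides_pirreducible_condition[OF p(2) I(1)]
      pirreducibleE(2)[OF subfieldE(1)[OF subfield_K] I(1,2)] by blast
  hence "p pdivides Irr K x"
    unfolding associated_def using pdivides_iff_shell[OF subfield_K p(1) I(1)] by simp
  moreover have "Irr K x pdivides ?P" by (rule G_extension_orbit_poly(2)[OF GE x(1)])
  moreover have pL: "p \<in> carrier (poly_ring L)"
    using carrier_polynomial_shell[OF subfieldE(1)[OF subfield_K] p(1)] .
  ultimately show "splitted p"
    using pdivides_imp_splitted[OF pL Irr_carrier[OF x(1)] Irr_not_Nil[OF x(1)]]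
      pdivides_imp_splitted[OF Irr_carrier[OF x(1)] P(1,2,4)] by blast
qed

lemma G_extension_imp_separable:
  assumes GE: "G_extension K L"
  shows "separable_extension K L"
  unfolding separable_extension_def
proof (intro conjI algebraic_ext ballI)
  fix x assume x: "x \<in> carrier L"
  let ?O = "(\<lambda>g. g x) ` G"
  let ?P = "linear_factor_prod L ?O"
  let ?i = "indexed_const :: 'a \<Rightarrow> ('a list \<times> nat) multiset \<Rightarrow> 'a"
  have O: "finite ?O" "?O \<subseteq> carrier L" using finite_G G_simps(1) x by auto
  interpret C: algebraic_closure alg_closure "?i ` carrier L" by (rule alg_closureE(1))
  have i: "?i \<in> ring_hom L alg_closure" by (rule alg_closureE(2))
  \<comment> \<open>In the closure the orbit polynomial is again a product of distinct linear factors.\<close>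
  note CF = C.field_axioms
  have iO: "finite (?i ` ?O)" "?i ` ?O \<subseteq> carrier alg_closure"
    using O ring_hom_memE(1)[OF i] by auto
  note P' = C.linear_factor_prod[OF iO]
  have iI: "map ?i (Irr K x) \<in> carrier (poly_ring alg_closure)"
    using polynomial_hom[OF i field_axioms CF Irr_carrier[OF x]] .
  have "map ?i (Irr K x) pdivides\<^bsub>alg_closure\<^esub> map ?i ?P"
    using map_poly_pdivides[OF i field_axioms CF Irr_carrier[OF x] G_extension_orbit_poly(2)[OF GE x]] .
  hence "C.roots (map ?i (Irr K x)) \<subseteq># mset_set (?i ` ?O)"
    using C.pdivides_imp_roots_incl[OF iI P'(1,2)] P'(3)
    unfolding map_linear_factor_prod[OF i field_axioms CF O(2)] by simp
  hence "count (C.roots (map ?i (Irr K x))) a \<le> 1" for a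
    using mset_subset_eq_count[of "C.roots (map ?i (Irr K x))" "mset_set (?i ` ?O)" a]
      count_mset_set(1)[OF iO(1), of a] count_mset_set(3)[of a "?i ` ?O"]
    by (cases "a \<in> ?i ` ?O") (auto simp del: indexed_const_def)
  thus "separable_poly L (Irr K x)"
    unfolding separable_poly_def \<sigma>_def
    using C.alg_mult_eq_count_roots[OF iI] Irr_not_Nil[OF x] by simp
qed

end

section \<open>Counting automorphisms of a Galois extension\<close>

text \<open>
  The homomorphism theorem, with the quotient realised as the image of \<open>\<phi>\<close>.
\<close>
lemma hom_factors_through_image:
  assumes "ring A" "ring B" "ring C" and \<phi>: "\<phi> \<in> ring_hom A B" and \<psi>: "\<psi> \<in> ring_hom A C"
    and ker: "\<And>p. p \<in> carrier A \<Longrightarrow> \<phi> p = \<zero>\<^bsub>B\<^esub> \<Longrightarrow> \<psi> p = \<zero>\<^bsub>C\<^esub>"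
  obtains \<theta> where "\<theta> \<in> ring_hom (B\<lparr>carrier := \<phi> ` carrier A\<rparr>) C" "\<theta> \<in> extensional (\<phi> ` carrier A)"
    "\<And>p. p \<in> carrier A \<Longrightarrow> \<theta> (\<phi> p) = \<psi> p"
proof -
  interpret A: ring A by fact
  interpret B: ring B by fact
  interpret C: ring C by fact
  interpret \<phi>: ring_hom_ring A B \<phi> using ring_hom_ringI2[OF A.ring_axioms B.ring_axioms \<phi>] .
  interpret \<psi>: ring_hom_ring A C \<psi> using ring_hom_ringI2[OF A.ring_axioms C.ring_axioms \<psi>] .
  have agree: "\<psi> p = \<psi> q" if "p \<in> carrier A" "q \<in> carrier A" "\<phi> p = \<phi> q" for p q
  proof -
    have "\<phi> (p \<ominus>\<^bsub>A\<^esub> q) = \<zero>\<^bsub>B\<^esub>"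
      using that unfolding a_minus_def by (simp add: B.r_neg)
    hence "\<psi> (p \<ominus>\<^bsub>A\<^esub> q) = \<zero>\<^bsub>C\<^esub>" using ker that by simp
    hence "\<psi> p \<ominus>\<^bsub>C\<^esub> \<psi> q = \<zero>\<^bsub>C\<^esub>" using that unfolding a_minus_def by simp
    thus ?thesis using that C.r_right_minus_eq by simp
  qed
  define \<theta> where "\<theta> = (\<lambda>y \<in> \<phi> ` carrier A. \<psi> (inv_into (carrier A) \<phi> y))"
  have \<theta>: "\<theta> (\<phi> p) = \<psi> p" if p: "p \<in> carrier A" for p
    unfolding \<theta>_def using p agree[OF inv_into_into[of "\<phi> p" \<phi> "carrier A"] p] f_inv_into_f[of "\<phi> p" \<phi> "carrier A"]
    by auto
  show thesis
  proof (rule that[of \<theta>])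
    show "\<theta> \<in> ring_hom (B\<lparr>carrier := \<phi> ` carrier A\<rparr>) C"
    proof (rule ring_hom_memI)
      fix x y assume "x \<in> carrier (B\<lparr>carrier := \<phi> ` carrier A\<rparr>)" "y \<in> carrier (B\<lparr>carrier := \<phi> ` carrier A\<rparr>)"
      then obtain p q where pq: "p \<in> carrier A" "x = \<phi> p" "q \<in> carrier A" "y = \<phi> q" by auto
      show "\<theta> (x \<otimes>\<^bsub>B\<lparr>carrier := \<phi> ` carrier A\<rparr>\<^esub> y) = \<theta> x \<otimes>\<^bsub>C\<^esub> \<theta> y"
        using \<theta>[of "p \<otimes>\<^bsub>A\<^esub> q"] \<theta>[of p] \<theta>[of q] pq by simp
      show "\<theta> (x \<oplus>\<^bsub>B\<lparr>carrier := \<phi> ` carrier A\<rparr>\<^esub> y) = \<theta> x \<oplus>\<^bsub>C\<^esub> \<theta> y"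
        using \<theta>[of "p \<oplus>\<^bsub>A\<^esub> q"] \<theta>[of p] \<theta>[of q] pq by simp
    qed (use \<theta> \<theta>[of "\<one>\<^bsub>A\<^esub>"] in auto)
  qed (use \<theta> in \<open>auto simp: \<theta>_def\<close>)
qed

context finite_field_extension
begin

text \<open>
  The \<open>K\<close>-embeddings of an intermediate field \<open>F\<close> into \<open>L\<close>; they are extensional on \<open>F\<close>, so that
  counting them as functions is counting them as maps on \<open>F\<close>.
\<close>
definition embeddings :: "'a set \<Rightarrow> ('a \<Rightarrow> 'a) set" where
  "embeddings F = {\<tau> \<in> ring_hom (L\<lparr>carrier := F\<rparr>) L \<inter> extensional F. \<forall>k \<in> K. \<tau> k = k}"

lemma map_embedding_hom:
  assumes F: "subfield F L" and \<tau>: "\<tau> \<in> embeddings F"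
  shows "map \<tau> \<in> ring_hom (F[X]) (poly_ring L)"
  using map_poly_ring_hom[OF _ subfield_iff(2)[OF F] field_axioms, of \<tau>] \<tau>
    univ_poly_consistent[OF subfieldE(1)[OF F]]
  unfolding embeddings_def by simp

text \<open>
  An embedding \<open>\<tau>\<close> of \<open>F\<close> extends to \<open>F(x)\<close> with any root \<open>r\<close> of the transported minimal polynomial as
  the image of \<open>x\<close>: as \<open>F(x)\<close> is the image of \<open>F[X]\<close> under evaluation at \<open>x\<close>, it suffices that
  \<open>p \<mapsto> (\<tau> p)(r)\<close> vanishes on the kernel of that evaluation, the multiples of the minimal polynomial.
\<close>
lemma embedding_extends:
  assumes F: "subfield F L" "K \<subseteq> F" and \<tau>: "\<tau> \<in> embeddings F" and x: "x \<in> carrier L"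
    and r: "r \<in> carrier L" "eval (map \<tau> (Irr F x)) r = \<zero>"
  obtains \<theta> where "\<theta> \<in> embeddings (simple_extension F x)" "\<theta> x = r" "\<And>c. c \<in> F \<Longrightarrow> \<theta> c = \<tau> c"
proof -
  note FR = subfieldE(1)[OF F(1)]
  have alg: "(algebraic over F) x"
    using algebraic_mono[OF F(2)] algebraic[OF x] .
  let ?\<phi> = "\<lambda>p. eval p x" and ?\<psi> = "(\<lambda>p. eval p r) \<circ> map \<tau>"
  have \<phi>: "?\<phi> \<in> ring_hom (F[X]) L" by (rule eval_is_hom[OF FR x])
  have \<psi>: "?\<psi> \<in> ring_hom (F[X]) L"
    using ring_hom_trans[OF map_embedding_hom[OF F(1) \<tau>] eval_is_hom[OF carrier_is_subring r(1)]] .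
  note I = IrrE[OF F(1) x alg]
  have ker: "?\<psi> p = \<zero>" if p: "p \<in> carrier (F[X])" and "?\<phi> p = \<zero>" for p
  proof -
    have "Irr F x divides\<^bsub>F[X]\<^esub> p"
      using Irr_minimal[OF F(1) x alg p] that(2) pdivides_iff_shell[OF F(1) I(1) p] by simp
    then obtain q where q: "q \<in> carrier (F[X])" "p = Irr F x \<otimes>\<^bsub>F[X]\<^esub> q" unfolding factor_def by blast
    have "?\<psi> p = ?\<psi> (Irr F x) \<otimes> ?\<psi> q"
      unfolding q(2) by (rule ring_hom_mult[OF \<psi> I(1) q(1)])
    also have "?\<psi> (Irr F x) = \<zero>" using r(2) by simp
    also have "\<zero> \<otimes> ?\<psi> q = \<zero>" using ring_hom_closed[OF \<psi> q(1)] by simp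
    finally show ?thesis .
  qed
  obtain \<theta> where \<theta>: "\<theta> \<in> ring_hom (L\<lparr>carrier := ?\<phi> ` carrier (F[X])\<rparr>) L"
      "\<theta> \<in> extensional (?\<phi> ` carrier (F[X]))" "\<And>p. p \<in> carrier (F[X]) \<Longrightarrow> \<theta> (?\<phi> p) = ?\<psi> p"
    using hom_factors_through_image[OF univ_poly_is_ring[OF FR] ring_axioms ring_axioms \<phi> \<psi> ker] by blast
  have img: "?\<phi> ` carrier (F[X]) = simple_extension F x"
    using simple_extension_as_eval_img[OF subfieldE(3)[OF F(1)] x] by simp
  have const: "\<theta> c = \<tau> c" if c: "c \<in> F" for c
  proof -
    have cL: "c \<in> carrier L" and \<tau>c: "\<tau> c \<in> carrier L" and \<tau>0: "\<tau> \<zero> = \<zero>"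
      using c subfieldE(3)[OF F(1)] \<tau> ring_hom_memE(1)[of \<tau> "L\<lparr>carrier := F\<rparr>" L] F(2)
        subringE(2)[OF subfieldE(1)[OF subfield_K]]
      unfolding embeddings_def by auto
    have 1: "normalize [c] \<in> carrier (F[X])"
      using normalize_gives_polynomial[of "[c]" F] c unfolding univ_poly_carrier by simp
    have "eval (normalize [c]) x = c" using cL x by simp
    moreover have "eval (map \<tau> (normalize [c])) r = \<tau> c" using \<tau>c \<tau>0 r(1) by simp
    ultimately show ?thesis using \<theta>(3)[OF 1] by simp
  qed
  show thesis
  proof (rule that[of \<theta>])
    show "\<theta> \<in> embeddings (simple_extension F x)"
      using \<theta>(1,2) const \<tau> F(2) unfolding img embeddings_def by auto
    have "X \<in> carrier (F[X])" by (rule var_closed(1)[OF FR])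
    from \<theta>(3)[OF this] have "\<theta> x = eval (map \<tau> X) r" using eval_var[OF x] by simp
    also have "map \<tau> X = X"
      using \<tau> subringE(2,3)[OF subfieldE(1)[OF subfield_K]] unfolding embeddings_def var_def by simp
    finally show "\<theta> x = r" using eval_var[OF r(1)] by simp
  qed (rule const)
qed

lemma separable_poly_alg_mult_le_one:
  assumes p: "p \<in> carrier (poly_ring L)" and sep: "separable_poly L p" and a: "a \<in> carrier L"
  shows "alg_mult p a \<le> 1"
proof -
  let ?i = "indexed_const :: 'a \<Rightarrow> ('a list \<times> nat) multiset \<Rightarrow> 'a"
  interpret C: algebraic_closure alg_closure "?i ` carrier L" by (rule alg_closureE(1))
  have i: "?i \<in> ring_hom L alg_closure" by (rule alg_closureE(2))
  have "alg_mult p a \<le> C.alg_mult (map ?i p) (?i a)"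
    using alg_mult_le_map_poly[OF i field_axioms C.field_axioms p _ a] sep
    unfolding separable_poly_def by blast
  also have "\<dots> \<le> 1"
    using sep ring_hom_closed[OF i a] unfolding separable_poly_def \<sigma>_def by blast
  finally show ?thesis .
qed

text \<open>
  The minimal polynomial of \<open>x\<close> over \<open>F\<close> divides the one over \<open>K\<close>. The latter is not changed by \<open>\<tau>\<close>, and
  in a Galois extension it is a product of distinct linear factors over \<open>L\<close>; hence so is the
  transported divisor.
\<close>
lemma galois_conjugate_roots:
  assumes gal: "galois_extension K L"
    and F: "subfield F L" "K \<subseteq> F" and \<tau>: "\<tau> \<in> embeddings F" and x: "x \<in> carrier L"
  shows "finite {r \<in> carrier L. eval (map \<tau> (Irr F x)) r = \<zero>}"
    and "card {r \<in> carrier L. eval (map \<tau> (Irr F x)) r = \<zero>} = degree (Irr F x)"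
proof -
  note FR = subfieldE(1)[OF F(1)]
  note alg = algebraic[OF x]
  have algF: "(algebraic over F) x" using algebraic_mono[OF F(2) alg] .
  note I = IrrE[OF subfield_K x alg] and J = IrrE[OF F(1) x algF]
  let ?p = "Irr K x" and ?q = "map \<tau> (Irr F x)"
  note pL = Irr_carrier[OF x] and p0 = Irr_not_Nil[OF x]
  have "is_root ?p x" unfolding is_root_def using x I(4) p0 by simp
  hence split: "splitted ?p"
    using gal I(1,2) unfolding galois_extension_def normal_extension_def by blast
  have simple: "alg_mult ?p a \<le> 1" if "a \<in> carrier L" for a
    using separable_poly_alg_mult_le_one[OF pL _ that] gal x
    unfolding galois_extension_def separable_extension_def by blast
  have "carrier (K[X]) \<subseteq> carrier (F[X])" using F(2) unfolding univ_poly_def polynomial_def by auto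
  hence pF: "?p \<in> carrier (F[X])" using I(1) by blast
  have "Irr F x divides\<^bsub>F[X]\<^esub> ?p"
    using Irr_minimal[OF F(1) x algF pF I(4)] pdivides_iff_shell[OF F(1) J(1) pF] by simp
  then obtain s where s: "s \<in> carrier (F[X])" "?p = Irr F x \<otimes>\<^bsub>F[X]\<^esub> s" unfolding factor_def by blast
  note h = ring_hom_memE[OF map_embedding_hom[OF F(1) \<tau>]]
  have "set ?p \<subseteq> K" using I(1) polynomial_incl unfolding univ_poly_carrier[symmetric] by blast
  hence "map \<tau> ?p = ?p" using \<tau> by (intro map_idI) (auto simp: embeddings_def)
  hence "?p = ?q \<otimes>\<^bsub>poly_ring L\<^esub> map \<tau> s" using h(2)[OF J(1) s(1)] s(2) by metis
  hence div: "?q pdivides ?p" using h(1)[OF s(1)] unfolding pdivides_def by auto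
  have qL: "?q \<in> carrier (poly_ring L)" using h(1)[OF J(1)] .
  have q0: "?q \<noteq> []" using pirreducibleE(1)[OF FR J(1,2)] by simp
  have incl: "roots ?q \<subseteq># roots ?p" using pdivides_imp_roots_incl[OF qL pL p0 div] .
  have split_q: "splitted ?q" using pdivides_imp_splitted[OF qL pL p0 split div] .
  have one: "count (roots ?q) a = 1" if "a \<in># roots ?q" for a
  proof -
    have "a \<in> carrier L" using that roots_mem_iff_is_root[OF qL] unfolding is_root_def by blast
    hence "count (roots ?p) a \<le> 1" using simple alg_mult_eq_count_roots[OF pL] by metis
    moreover have "count (roots ?q) a \<le> count (roots ?p) a" using mset_subset_eq_count[OF incl] .
    moreover have "count (roots ?q) a > 0" using that by simp
    ultimately show ?thesis by linarith
  qed
  have set_eq: "{r \<in> carrier L. eval ?q r = \<zero>} = set_mset (roots ?q)"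
    using roots_mem_iff_is_root[OF qL] q0 unfolding is_root_def by auto
  thus "finite {r \<in> carrier L. eval ?q r = \<zero>}" by simp
  have "size (roots ?q) = card (set_mset (roots ?q))"
    unfolding size_multiset_overloaded_eq using one by simp
  thus "card {r \<in> carrier L. eval ?q r = \<zero>} = degree (Irr F x)"
    using set_eq split_q unfolding splitted_def by simp
qed

text \<open>
  When \<open>x\<close> is adjoined to \<open>F\<close>, each embedding of \<open>F\<close> extends in as many ways as the minimal polynomial of
  \<open>x\<close> over \<open>F\<close> has degree, and the dimension grows by the same factor. The conclusion speaks of a finite set of
  embeddings, since \<open>card\<close> of the set of all embeddings would be meaningful only once that set is known
  to be finite.
\<close>
lemma galois_embedding_count:
  assumes gal: "galois_extension K L" and xs: "set xs \<subseteq> carrier L"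
  shows "\<exists>S \<subseteq> embeddings (finite_extension K xs). finite S \<and> card S = dim K (finite_extension K xs)"
  using xs
proof (induction xs)
  case Nil
  have "dim K K = 1" using dimI[OF subfield_K dimension_one[OF subfield_K]] by (simp add: over_def)
  moreover have "(\<lambda>k \<in> K. k) \<in> embeddings K"
    using subfieldE(3)[OF subfield_K] subringE(3,6,7)[OF subfieldE(1)[OF subfield_K]]
    unfolding embeddings_def by (auto intro!: ring_hom_memI)
  ultimately show ?case by (intro exI[of _ "{\<lambda>k \<in> K. k}"]) simp
next
  case (Cons x xs)
  define F where "F = finite_extension K xs"
  have x: "x \<in> carrier L" and xs: "set xs \<subseteq> carrier L" using Cons.prems by auto
  have F: "subfield F L" "K \<subseteq> F" "finite_dimension K F"
    unfolding F_def using algebraic xs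
    by (auto intro: finite_extension_is_subfield[OF subfield_K xs] finite_extension_finite_dimension(1)[OF subfield_K xs]
        simp del: finite_extension.simps dest: subsetD[OF finite_extension_incl[OF subfieldE(3)[OF subfield_K] xs]])
  have algF: "(algebraic over F) x" using algebraic_mono[OF F(2) algebraic[OF x]] .
  have ext: "finite_extension K (x # xs) = simple_extension F x" by (simp add: F_def)
  let ?F' = "simple_extension F x" and ?d = "degree (Irr F x)"
  obtain S where S: "S \<subseteq> embeddings F" "finite S" "card S = dim K F"
    using Cons.IH[OF xs] unfolding F_def by blast
  define R where "R = (\<lambda>\<tau>. {r \<in> carrier L. eval (map \<tau> (Irr F x)) r = \<zero>})"
  have R: "finite (R \<tau>)" "card (R \<tau>) = ?d" if "\<tau> \<in> S" for \<tau>
    unfolding R_def using galois_conjugate_roots[OF gal F(1,2) _ x] S(1) that by blast+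
  have "\<exists>\<theta>. \<theta> \<in> embeddings ?F' \<and> \<theta> x = r \<and> (\<forall>c \<in> F. \<theta> c = \<tau> c)" if "\<tau> \<in> S" "r \<in> R \<tau>" for \<tau> r
  proof -
    have "\<tau> \<in> embeddings F" "r \<in> carrier L" "eval (map \<tau> (Irr F x)) r = \<zero>"
      using that S(1) unfolding R_def by auto
    from embedding_extends[OF F(1,2) this(1) x this(2,3)] show ?thesis by metis
  qed
  then obtain e where e: "\<And>\<tau> r. \<tau> \<in> S \<Longrightarrow> r \<in> R \<tau> \<Longrightarrow> e \<tau> r \<in> embeddings ?F'"
      "\<And>\<tau> r. \<tau> \<in> S \<Longrightarrow> r \<in> R \<tau> \<Longrightarrow> e \<tau> r x = r"
      "\<And>\<tau> r c. \<tau> \<in> S \<Longrightarrow> r \<in> R \<tau> \<Longrightarrow> c \<in> F \<Longrightarrow> e \<tau> r c = \<tau> c" by metis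
  let ?e = "\<lambda>(\<tau>, r). e \<tau> r"
  \<comment> \<open>An extension determines \<open>r\<close> by its value at \<open>x\<close>, and \<open>\<tau>\<close> by its restriction to \<open>F\<close>.\<close>
  have inj: "inj_on ?e (Sigma S R)"
  proof (rule inj_onI, clarify)
    fix \<tau> r \<tau>' r' assume *: "\<tau> \<in> S" "r \<in> R \<tau>" "\<tau>' \<in> S" "r' \<in> R \<tau>'" "e \<tau> r = e \<tau>' r'"
    have "r = r'" using e(2)[OF *(1,2)] e(2)[OF *(3,4)] *(5) by simp
    moreover have "\<tau> = \<tau>'"
    proof (rule extensionalityI)
      show "\<tau> \<in> extensional F" "\<tau>' \<in> extensional F" using * S(1) unfolding embeddings_def by auto
      show "\<tau> c = \<tau>' c" if "c \<in> F" for c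
        using e(3)[OF *(1,2) that] e(3)[OF *(3,4) that] *(5) by simp
    qed
    ultimately show "\<tau> = \<tau>' \<and> r = r'" by simp
  qed
  have "card (?e ` Sigma S R) = (\<Sum>\<tau> \<in> S. card (R \<tau>))"
    using card_image[OF inj] card_SigmaI[OF S(2), of R] R(1) by metis
  also have "\<dots> = card S * ?d" using R(2) by simp
  also have "\<dots> = dim K ?F'"
    using telescopic_base_dim(2)[OF subfield_K F(1,3), of ?F'] simple_extension_dim[OF F(1) x algF]
      finite_dimension_simple_extension[OF F(1) x] algF S(3) by (simp add: over_def)
  finally have "card (?e ` Sigma S R) = dim K ?F'" .
  moreover have "finite (?e ` Sigma S R)" using S(2) R(1) by simp
  moreover have "?e ` Sigma S R \<subseteq> embeddings ?F'" using e(1) by auto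
  ultimately show ?case unfolding ext by blast
qed

text \<open>
  An injective \<open>K\<close>-linear endomorphism of a finite-dimensional space is surjective.
\<close>
lemma embeddings_carrier: "embeddings (carrier L) \<subseteq> G"
proof
  fix h assume "h \<in> embeddings (carrier L)"
  hence h: "h \<in> ring_hom L L" "h \<in> extensional (carrier L)" "\<And>k. k \<in> K \<Longrightarrow> h k = k"
    unfolding embeddings_def by auto
  interpret h: ring_hom_ring L L h using ring_hom_ringI2[OF ring_axioms ring_axioms h(1)] .
  have inj: "inj_on h (carrier L)"
    using non_trivial_field_hom_is_inj[OF h(1) field_axioms field_axioms] .
  have "h ` K = K" using h(3) by force
  hence dim: "dimension n K (h ` carrier L)"
    using h.inj_hom_dimension[OF subfield_K one_not_zero inj dimension_n] by simp
  obtain Us where Us: "set Us \<subseteq> carrier L" "independent K Us" "length Us = n" "Span K Us = h ` carrier L"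
    using exists_base[OF subfield_K dim] by blast
  have "h ` carrier L = carrier L"
    using independent_length_eq_dimension[OF subfield_K dimension_n Us(2,1)] Us(3,4) by simp
  hence "bij_betw h (carrier L) (carrier L)" using inj unfolding bij_betw_def by blast
  thus "h \<in> G" using h unfolding G_iff ring_iso_def by blast
qed

lemma galois_imp_card_G:
  assumes gal: "galois_extension K L"
  shows "card G = n"
proof -
  obtain Us where Us: "set Us \<subseteq> carrier L" "independent K Us" "length Us = n" "Span K Us = carrier L"
    using exists_base[OF subfield_K dimension_n] by blast
  let ?F = "finite_extension K Us"
  have FR: "subring ?F L" using finite_extension_is_subring[OF subfieldE(1)[OF subfield_K] Us(1)] .
  have KF: "K \<subseteq> ?F" using finite_extension_incl[OF subfieldE(3)[OF subfield_K] Us(1)] .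
  have "subalgebra K ?F L"
    using subring.axioms(1)[OF FR] subringE(6)[OF FR] KF
    by (intro subalgebra.intro subalgebra_axioms.intro) blast+
  hence "carrier L \<subseteq> ?F"
    using subalgebra_Span_incl[OF subfield_K _ finite_extension_mem[OF subfieldE(1)[OF subfield_K] Us(1)]] Us(4) by simp
  hence eq: "?F = carrier L" using subringE(1)[OF FR] by blast
  obtain S where S: "S \<subseteq> G" "card S = n"
    using galois_embedding_count[OF gal Us(1)] embeddings_carrier unfolding eq by blast
  thus ?thesis using card_mono[OF finite_G S(1)] card_G_le by simp
qed

end

section \<open>The equivalence\<close>

theorem proposition3p1:
  fixes L :: "('a, 'b) ring_scheme" and K :: "'a set"
  assumes "field L" and "subfield K L" and "ring.finite_dimension L K (carrier L)"
  shows "(galois_extension K L \<longleftrightarrow> order (aut_group K L) = ring.dim L K (carrier L)) \<and>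
         (order (aut_group K L) = ring.dim L K (carrier L) \<longleftrightarrow> G_extension K L)"
proof -
  interpret finite_field_extension K L
    using assms by (intro finite_field_extension.intro finite_field_extension_axioms.intro)
  have "G_extension K L \<Longrightarrow> galois_extension K L"
    unfolding galois_extension_def
    using G_extension_imp_normal G_extension_imp_separable by blast
  thus ?thesis
    unfolding order_def using card_G_eq_iff_G_extension galois_imp_card_G by blast
qed

end
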